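(* Let $T>0$, $q\in(1,\infty)$, $1/q+1/q'=1$, $n\ge 2$, let $X,\mathcal D$ be reflexive Banach spaces with $\mathcal D$ continuously and densely embedded in $X$, let $\vartheta\in(1/q',1)$, $\psi_1,\dots,\psi_{n-1}\in (X,\mathcal D)_{\vartheta,\infty}$, $Z:=(X^*,\mathcal D^* )_{\vartheta,1}$ (so that $Z^*=(X,\mathcal D)_{\vartheta,\infty}$), and $\alpha\in[0,\vartheta-1/q')$. Then the switching-point-to-control operator $$\bar B:\mathbb R^n\to[C^{0,\alpha}(0,T;Z)]^*,\qquad \langle\bar B(\tau),v\rangle:=\int_{\mathbb R}\sum_{i=1}^{n-1}\bar\chi_{[\tau_i,\tau_{i+1})}(t)\,\langle\psi_i,V(t)\rangle_{Z^*,Z}\,dt$$ is continuously Fréchet-differentiable from $\mathbb R^n$ to $[C^{0,\alpha}(0,T;Z)]^*$. Its directional derivative at $\tau\in\mathbb R^n$ in direction $h\in\mathbb R^n$ is given by $$\langle\bar B'(\tau)h,v\rangle=\sum_{i=1}^{n-1}\langle\psi_i,\;h_{i+1}V(\tau_{i+1})-h_iV(\tau_i)\rangle_{Z^*,Z}\qquad\forall\,v\in C^{0,\alpha}(0,T;Z).$$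
   Context: $(\cdot,\cdot)_{\theta,r}$ denotes real interpolation. $C^{0,\alpha}(0,T;Z)$ is the space of $\alpha$-Hölder continuous functions on $[0,T]$ with values in $Z$, with its usual norm, and $[\cdot]^*$ denotes the dual space. For $v\in C^{0,\alpha}(0,T;Z)$, $V:\mathbb R\to Z$ is its extension by constant continuation, $V(t):=v(\min\{\max\{t,0\},T\})$. For $a,b,t\in\mathbb R$, the modified (signed) characteristic function is $$\bar\chi_{[a,b)}(t):=\begin{cases}1,& a\le t<b,\\-1,& b<t\le a,\\0,&\text{else.}\end{cases}$$
   Formalization: Continuous Fréchet differentiability is stated only for α>0, since it fails at α=0 (e.g. X=D=ℝ, n=2, ψ_1=1); at α=0, B̄ maps into the dual and the directional derivative formula holds for each fixed v. *)

theory Defs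
  imports "HOL-Analysis.Analysis" "HOL-Library.Function_Algebras"
begin

text \<open>
  Real-valued functionals are manipulated pointwise, so the function space is made a real
  vector space.
\<close>

instantiation "fun" :: (type, real_vector) real_vector
begin

definition scaleR_fun :: "real \<Rightarrow> ('a \<Rightarrow> 'b) \<Rightarrow> 'a \<Rightarrow> 'b"
  where "scaleR_fun c f = (\<lambda>x. c *\<^sub>R f x)"

instance
  by standard (auto simp: scaleR_fun_def plus_fun_def fun_eq_iff algebra_simps)

end


section \<open>Normed spaces on a carrier set and their duals\<close>

text \<open>
  Interpolation spaces and Hoelder spaces depend on term parameters and therefore cannot be
  types. Such a space is given by a linear subspace \<open>E\<close> of a vector space and a norm
  \<open>N\<close> on it. Elements of the dual are normalised to vanish outside \<open>E\<close>, so that a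
  functional on \<open>E\<close> has exactly one representative.
\<close>

definition dual_space :: "'v::real_vector set \<Rightarrow> ('v \<Rightarrow> real) \<Rightarrow> ('v \<Rightarrow> real) set" where
  "dual_space E N =
    {l. (\<forall>u\<in>E. \<forall>v\<in>E. l (u + v) = l u + l v) \<and>
        (\<forall>c. \<forall>v\<in>E. l (c *\<^sub>R v) = c * l v) \<and>
        (\<exists>C. \<forall>v\<in>E. \<bar>l v\<bar> \<le> C * N v) \<and>
        (\<forall>v. v \<notin> E \<longrightarrow> l v = 0)}"

definition dual_norm :: "'v::real_vector set \<Rightarrow> ('v \<Rightarrow> real) \<Rightarrow> ('v \<Rightarrow> real) \<Rightarrow> real" where
  "dual_norm E N l = (SUP v\<in>{v\<in>E. N v \<le> 1}. \<bar>l v\<bar>)"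

definition bounded_linear_into ::
  "'b::real_vector set \<Rightarrow> ('b \<Rightarrow> real) \<Rightarrow> ('a::real_normed_vector \<Rightarrow> 'b) \<Rightarrow> bool" where
  "bounded_linear_into Y N A \<longleftrightarrow>
     linear A \<and> range A \<subseteq> Y \<and> (\<exists>C. \<forall>h. N (A h) \<le> C * norm h)"

definition frechet_deriv_into ::
  "'b::real_vector set \<Rightarrow> ('b \<Rightarrow> real) \<Rightarrow> ('a::real_normed_vector \<Rightarrow> 'b) \<Rightarrow> ('a \<Rightarrow> 'b) \<Rightarrow> 'a \<Rightarrow> bool"
  where
  "frechet_deriv_into Y N F A x \<longleftrightarrow>
     bounded_linear_into Y N A \<and>
     ((\<lambda>h. N (F (x + h) - F x - A h) / norm h) \<longlongrightarrow> 0) (at 0)"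

text \<open>
  \<open>F\<close> maps the whole space into \<open>(Y, N)\<close> and has the Frechet derivative
  \<open>F' x\<close> at each \<open>x\<close>; the map \<open>F'\<close> is continuous for the operator norm.
\<close>

definition cont_frechet_diff_into ::
  "'b::real_vector set \<Rightarrow> ('b \<Rightarrow> real) \<Rightarrow> ('a::real_normed_vector \<Rightarrow> 'b) \<Rightarrow> ('a \<Rightarrow> 'a \<Rightarrow> 'b) \<Rightarrow> bool"
  where
  "cont_frechet_diff_into Y N F F' \<longleftrightarrow>
     range F \<subseteq> Y \<and>
     (\<forall>x. frechet_deriv_into Y N F (F' x) x) \<and>
     (\<forall>x. ((\<lambda>y. SUP h\<in>cball 0 1. N (F' y h - F' x h)) \<longlongrightarrow> 0) (at x))"

definition reflexive :: "'a::real_normed_vector itself \<Rightarrow> bool" where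
  "reflexive (_ :: 'a itself) \<longleftrightarrow>
     (\<forall>\<phi> :: ('a \<Rightarrow>\<^sub>L real) \<Rightarrow>\<^sub>L real. \<exists>x :: 'a. \<forall>f. blinfun_apply \<phi> f = blinfun_apply f x)"


section \<open>Real interpolation (K-method)\<close>

text \<open>
  An interpolation couple consists of two normed spaces with injections \<open>j0\<close>,
  \<open>j1\<close> into a common ambient space \<open>'v\<close>. The infimum below is meaningful for
  \<open>v\<close> in the sum of the two images only.
\<close>

definition K_functional ::
  "('a::real_normed_vector \<Rightarrow> 'v::real_normed_vector) \<Rightarrow> ('b::real_normed_vector \<Rightarrow> 'v)
    \<Rightarrow> real \<Rightarrow> 'v \<Rightarrow> real" where
  "K_functional j0 j1 t v =
     (INF p\<in>{(a, b). v = j0 a + j1 b}. norm (fst p) + t * norm (snd p))"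

definition interp_ennorm ::
  "('a::real_normed_vector \<Rightarrow> 'v::real_normed_vector) \<Rightarrow> ('b::real_normed_vector \<Rightarrow> 'v)
    \<Rightarrow> real \<Rightarrow> ennreal \<Rightarrow> 'v \<Rightarrow> ennreal" where
  "interp_ennorm j0 j1 \<theta> r v =
     (if r = \<infinity> then (SUP t\<in>{0<..}. ennreal (t powr (-\<theta>) * K_functional j0 j1 t v))
      else (let I = (\<integral>\<^sup>+t\<in>{0<..}. ennreal ((t powr (-\<theta>) * K_functional j0 j1 t v) powr enn2real r / t) \<partial>lborel)
            in if I = \<infinity> then \<infinity> else ennreal (enn2real I powr (1 / enn2real r))))"

definition interp_space ::
  "('a::real_normed_vector \<Rightarrow> 'v::real_normed_vector) \<Rightarrow> ('b::real_normed_vector \<Rightarrow> 'v)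
    \<Rightarrow> real \<Rightarrow> ennreal \<Rightarrow> 'v set" where
  "interp_space j0 j1 \<theta> r =
     {v. (\<exists>a b. v = j0 a + j1 b) \<and> interp_ennorm j0 j1 \<theta> r v < \<infinity>}"

definition interp_norm ::
  "('a::real_normed_vector \<Rightarrow> 'v::real_normed_vector) \<Rightarrow> ('b::real_normed_vector \<Rightarrow> 'v)
    \<Rightarrow> real \<Rightarrow> ennreal \<Rightarrow> 'v \<Rightarrow> real" where
  "interp_norm j0 j1 \<theta> r v = enn2real (interp_ennorm j0 j1 \<theta> r v)"

text \<open>
  For a dense continuous embedding \<open>\<iota> : D \<rightarrow> X\<close>, the adjoint \<open>f \<mapsto> f \<circ> \<iota>\<close>
  embeds the dual of \<open>X\<close> into that of \<open>D\<close>; this makes the duals a couple with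
  ambient space the dual of \<open>D\<close>.
\<close>

definition dual_embedding ::
  "('d::real_normed_vector \<Rightarrow>\<^sub>L 'x::real_normed_vector) \<Rightarrow> ('x \<Rightarrow>\<^sub>L real) \<Rightarrow> ('d \<Rightarrow>\<^sub>L real)" where
  "dual_embedding \<iota> f = f o\<^sub>L \<iota>"

definition Z_space :: "('d::real_normed_vector \<Rightarrow>\<^sub>L 'x::real_normed_vector) \<Rightarrow> real \<Rightarrow> ('d \<Rightarrow>\<^sub>L real) set"
  where "Z_space \<iota> \<theta> = interp_space (dual_embedding \<iota>) (\<lambda>g. g) \<theta> 1"

definition Z_norm :: "('d::real_normed_vector \<Rightarrow>\<^sub>L 'x::real_normed_vector) \<Rightarrow> real \<Rightarrow> ('d \<Rightarrow>\<^sub>L real) \<Rightarrow> real"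
  where "Z_norm \<iota> \<theta> = interp_norm (dual_embedding \<iota>) (\<lambda>g. g) \<theta> 1"

text \<open>
  The identification of \<open>(X, D)\<^sub>\<theta>\<^sub>,\<^sub>\<infinity>\<close> with the dual of \<open>Z = (X*, D*)\<^sub>\<theta>\<^sub>,\<^sub>1\<close>:
  \<open>\<psi>\<close> acts on the dense subspace \<open>X*\<close> of \<open>Z\<close> by evaluation \<open>f \<mapsto> f \<psi>\<close>,
  and \<open>Z_pairing \<iota> \<theta> \<psi>\<close> is the unique bounded extension of this to \<open>Z\<close>.
\<close>

definition Z_pairing ::
  "('d::real_normed_vector \<Rightarrow>\<^sub>L 'x::real_normed_vector) \<Rightarrow> real \<Rightarrow> 'x \<Rightarrow> ('d \<Rightarrow>\<^sub>L real) \<Rightarrow> real" where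
  "Z_pairing \<iota> \<theta> \<psi> =
     (THE l. l \<in> dual_space (Z_space \<iota> \<theta>) (Z_norm \<iota> \<theta>) \<and>
             (\<forall>f. l (dual_embedding \<iota> f) = blinfun_apply f \<psi>))"


section \<open>Hoelder continuous functions on \<open>[0,T]\<close>\<close>

text \<open>
  Functions on \<open>[0,T]\<close> are represented by their extension by \<open>0\<close>, which is a unique
  representative. Continuity is implied by the Hoelder condition for \<open>\<alpha> > 0\<close>; for
  \<open>\<alpha> = 0\<close> it implements the convention that \<open>C\<^sup>0\<^sup>,\<^sup>0\<close> is the space of
  continuous functions.
\<close>

definition holder_space ::
  "real \<Rightarrow> real \<Rightarrow> 'z::real_vector set \<Rightarrow> ('z \<Rightarrow> real) \<Rightarrow> (real \<Rightarrow> 'z) set" where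
  "holder_space T \<alpha> Z N =
    {v. (\<forall>t\<in>{0..T}. v t \<in> Z) \<and> (\<forall>t. t \<notin> {0..T} \<longrightarrow> v t = 0) \<and>
        (\<forall>t\<in>{0..T}. ((\<lambda>s. N (v s - v t)) \<longlongrightarrow> 0) (at t within {0..T})) \<and>
        (\<exists>C. \<forall>s\<in>{0..T}. \<forall>t\<in>{0..T}. N (v t - v s) \<le> C * \<bar>t - s\<bar> powr \<alpha>)}"

definition holder_norm ::
  "real \<Rightarrow> real \<Rightarrow> ('z::real_vector \<Rightarrow> real) \<Rightarrow> (real \<Rightarrow> 'z) \<Rightarrow> real" where
  "holder_norm T \<alpha> N v =
     (SUP t\<in>{0..T}. N (v t)) +
     (SUP p\<in>{(s, t). s \<in> {0..T} \<and> t \<in> {0..T} \<and> s \<noteq> t}.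
        N (v (snd p) - v (fst p)) / \<bar>snd p - fst p\<bar> powr \<alpha>)"

definition const_ext :: "real \<Rightarrow> (real \<Rightarrow> 'z) \<Rightarrow> real \<Rightarrow> 'z" where
  "const_ext T v t = v (min (max t 0) T)"


section \<open>The switching-point-to-control operator\<close>

definition chi_bar :: "real \<Rightarrow> real \<Rightarrow> real \<Rightarrow> real" where
  "chi_bar a b t = (if a \<le> t \<and> t < b then 1 else if b < t \<and> t \<le> a then -1 else 0)"

text \<open>
  The coordinates of \<open>\<tau>\<close> are numbered by an enumeration \<open>e\<close> of the index type:
  \<open>\<tau> $ e i\<close> is the \<open>i\<close>-th switching point, \<open>i = 1, ..., n\<close>.
\<close>

definition switching_op ::
  "('d::real_normed_vector \<Rightarrow>\<^sub>L 'x::real_normed_vector) \<Rightarrow> real \<Rightarrow> real \<Rightarrow> real \<Rightarrow> nat \<Rightarrow> (nat \<Rightarrow> 'n::finite)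
    \<Rightarrow> (nat \<Rightarrow> 'x) \<Rightarrow> real ^ 'n \<Rightarrow> (real \<Rightarrow> ('d \<Rightarrow>\<^sub>L real)) \<Rightarrow> real" where
  "switching_op \<iota> \<theta> T \<alpha> n e \<psi> \<tau> v =
     (if v \<in> holder_space T \<alpha> (Z_space \<iota> \<theta>) (Z_norm \<iota> \<theta>)
      then (LINT t|lborel. (\<Sum>i=1..n-1. chi_bar (\<tau> $ e i) (\<tau> $ e (i+1)) t *
                                         Z_pairing \<iota> \<theta> (\<psi> i) (const_ext T v t)))
      else 0)"

end

theory Submission
  imports Defs
begin

text \<open>
  The functional \<open>f \<mapsto> f \<psi>\<close> on the dual of \<open>X\<close> is bounded for the norm of
  \<open>Z\<close>: with near-optimal splittings of \<open>f\<close> at the dyadic levels \<open>s = 2\<^sup>j\<close>, the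
  difference of consecutive first components is tested against a splitting of \<open>\<psi>\<close> at level
  \<open>1 / s\<close>, which gives \<open>K(s, f) / s\<^sup>\<theta>\<close> up to a constant, and the sum of these terms is
  dominated by the \<open>Z\<close>-norm. Together with the density of the dual of \<open>X\<close> in \<open>Z\<close> this
  makes the pairing with \<open>\<psi>\<close> a bounded functional on \<open>Z\<close>. For a Hoelder function
  \<open>v\<close> the functions \<open>t \<mapsto> \<langle>\<psi>\<^sub>i, V t\<rangle>\<close> are then \<open>\<alpha>\<close>-Hoelder on the line; if
  \<open>F\<^sub>i\<close> denotes an antiderivative, the operator is \<open>\<Sum>i. F\<^sub>i(\<tau>\<^sub>i\<^sub>+\<^sub>1) - F\<^sub>i(\<tau>\<^sub>i)\<close>, and its Taylor
  remainder is of order \<open>1 + \<alpha>\<close> uniformly in the unit ball.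
\<close>


section \<open>Seminorms on a subspace\<close>

text \<open>Carrier and \<open>N\<close> are terms, so that the interpolation space and the spaces
  built on it can be instances. Nonnegativity is derived, from the triangle inequality for
  \<open>v\<close> and \<open>- v\<close>.\<close>

locale seminorm_on =
  fixes E :: "'v::real_vector set" and N :: "'v \<Rightarrow> real"
  assumes subspace: "subspace E"
    and triangle: "u \<in> E \<Longrightarrow> v \<in> E \<Longrightarrow> N (u + v) \<le> N u + N v"
    and homogeneous: "v \<in> E \<Longrightarrow> N (c *\<^sub>R v) = \<bar>c\<bar> * N v"
begin

lemma N_zero [simp]: "N 0 = 0"
  using homogeneous[of 0 0] subspace_0[OF subspace] by simp

lemma N_minus: "v \<in> E \<Longrightarrow> N (- v) = N v"
  using homogeneous[of v "-1"] by simp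

lemma N_diff: "u \<in> E \<Longrightarrow> v \<in> E \<Longrightarrow> N (u - v) \<le> N u + N v"
  using triangle[of u "- v"] N_minus[of v] subspace_neg[OF subspace, of v] by simp

lemma N_nonneg: "v \<in> E \<Longrightarrow> 0 \<le> N v"
  using N_diff[of v v] by simp

lemma dual_diff:
  assumes "l \<in> dual_space E N" "u \<in> E" "v \<in> E"
  shows "l (u - v) = l u - l v"
proof -
  have v: "(-1) *\<^sub>R v \<in> E"
    using assms(3) subspace by (rule subspace_scale[rotated])
  have "l (u + (-1) *\<^sub>R v) = l u + l ((-1) *\<^sub>R v)"
    using assms(1,2) v unfolding dual_space_def by blast
  also have "l ((-1) *\<^sub>R v) = (-1) * l v"
    using assms(1,3) unfolding dual_space_def by blast
  finally have "l (u + (-1) *\<^sub>R v) = l u + (-1) * l v" .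
  then show ?thesis by simp
qed

lemma dual_boundE:
  assumes "l \<in> dual_space E N"
  obtains C where "C \<ge> 0" "\<And>v. v \<in> E \<Longrightarrow> \<bar>l v\<bar> \<le> C * N v"
proof -
  obtain C where C: "\<forall>v\<in>E. \<bar>l v\<bar> \<le> C * N v"
    using assms unfolding dual_space_def by auto
  have "\<bar>l v\<bar> \<le> \<bar>C\<bar> * N v" if "v \<in> E" for v
    using C that mult_right_mono[OF abs_ge_self[of C] N_nonneg[OF that]] by fastforce
  then show ?thesis using that[of "\<bar>C\<bar>"] by auto
qed

text \<open>Extension by density: the values of \<open>\<phi>\<close> along approximants of
  \<open>g\<close> form a Cauchy sequence of reals, so completeness of the reals suffices to define
  the limit. Unique existence is the form needed to evaluate the \<open>THE\<close> in
  \<open>Z_pairing\<close>.\<close>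

lemma dual_extension:
  fixes J :: "'a::real_vector \<Rightarrow> 'v" and \<phi> :: "'a \<Rightarrow> real"
  assumes J: "linear J" "range J \<subseteq> E"
    and dense: "\<And>g \<epsilon>. g \<in> E \<Longrightarrow> \<epsilon> > 0 \<Longrightarrow> \<exists>f. N (g - J f) < \<epsilon>"
    and \<phi>: "linear \<phi>" and bound: "\<And>f. \<bar>\<phi> f\<bar> \<le> C * N (J f)"
  shows "\<exists>!l. l \<in> dual_space E N \<and> (\<forall>f. l (J f) = \<phi> f)"
proof -
  have JE: "J f \<in> E" for f using J(2) by auto
  have "\<exists>p. \<forall>n. N (g - J (p n)) < inverse (real (Suc n))" if "g \<in> E" for g
    using dense[OF that] by (intro choice) auto
  then obtain p where p: "\<And>g n. g \<in> E \<Longrightarrow> N (g - J (p g n)) < inverse (real (Suc n))"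
    by metis
  have p_lim: "(\<lambda>n. N (g - J (p g n))) \<longlonglongrightarrow> 0" if "g \<in> E" for g
  proof (rule tendsto_sandwich[OF _ _ tendsto_const LIMSEQ_inverse_real_of_nat])
    show "\<forall>\<^sub>F n in sequentially. 0 \<le> N (g - J (p g n))"
      using that JE subspace_diff[OF subspace] N_nonneg by auto
    show "\<forall>\<^sub>F n in sequentially. N (g - J (p g n)) \<le> inverse (real (Suc n))"
      using p[OF that] by (intro always_eventually allI less_imp_le)
  qed
  define l where "l g = (if g \<in> E then lim (\<lambda>n. \<phi> (p g n)) else 0)" for g
  \<comment> \<open>Two approximants of the same \<open>g\<close> are compared. This one inequality
    gives the Cauchy property, the independence of the approximating sequence and, with
    \<open>f' = 0\<close>, the bound on \<open>l\<close>.\<close>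
  have bound': "\<bar>\<phi> f - \<phi> f'\<bar> \<le> \<bar>C\<bar> * (N (g - J f) + N (g - J f'))" if "g \<in> E" for g f f'
  proof -
    have *: "J f - J f' = (g - J f') - (g - J f)" by simp
    have "\<bar>\<phi> f - \<phi> f'\<bar> \<le> C * N (J f - J f')"
      using bound[of "f - f'"] by (simp add: linear_diff[OF J(1)] linear_diff[OF \<phi>])
    also have "\<dots> \<le> \<bar>C\<bar> * N (J f - J f')"
      using JE subspace_diff[OF subspace] by (intro mult_right_mono N_nonneg) auto
    also have "N (J f - J f') \<le> N (g - J f) + N (g - J f')"
      unfolding * using N_diff[of "g - J f'" "g - J f"] that JE subspace_diff[OF subspace]
      by auto
    finally show ?thesis by (simp add: mult_left_mono)
  qed
  have conv: "(\<lambda>n. \<phi> (p g n)) \<longlonglongrightarrow> l g" if g: "g \<in> E" for g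
  proof -
    have "Cauchy (\<lambda>n. \<phi> (p g n))"
    proof (rule metric_CauchyI)
      fix \<epsilon> :: real assume "\<epsilon> > 0"
      \<comment> \<open>The added 1 keeps the denominator positive when
        \<open>C = 0\<close>.\<close>
      then have "\<epsilon> / (2 * (\<bar>C\<bar> + 1)) > 0" by simp
      then obtain n0 where n0: "\<And>n. n \<ge> n0 \<Longrightarrow> N (g - J (p g n)) < \<epsilon> / (2 * (\<bar>C\<bar> + 1))"
        using order_tendstoD(2)[OF p_lim[OF g]] unfolding eventually_sequentially by blast
      have "dist (\<phi> (p g m)) (\<phi> (p g n)) < \<epsilon>" if "m \<ge> n0" "n \<ge> n0" for m n
      proof -
        have nn: "0 \<le> N (g - J (p g m)) + N (g - J (p g n))"
          using g JE subspace_diff[OF subspace] by (intro add_nonneg_nonneg N_nonneg) auto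
        have "(\<bar>C\<bar> + 1) * N (g - J (p g k)) < \<epsilon> / 2" if "k \<ge> n0" for k
          using n0[OF that] by (simp add: pos_less_divide_eq add_pos_nonneg algebra_simps)
        from this[OF that(1)] this[OF that(2)]
        have "(\<bar>C\<bar> + 1) * (N (g - J (p g m)) + N (g - J (p g n))) < \<epsilon>"
          unfolding distrib_left by linarith
        then show ?thesis
          using bound'[OF g, of "p g m" "p g n"] nn unfolding dist_real_def
          by (simp add: algebra_simps)
      qed
      then show "\<exists>M. \<forall>m\<ge>M. \<forall>n\<ge>M. dist (\<phi> (p g m)) (\<phi> (p g n)) < \<epsilon>" by blast
    qed
    then show ?thesis
      using g unfolding l_def by (simp add: Cauchy_convergent_iff convergent_LIMSEQ_iff)
  qed
  \<comment> \<open>The limit may be computed along any approximating sequence, such as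
    \<open>p u n + p v n\<close> for \<open>u + v\<close>; linearity of \<open>l\<close> follows
    from this.\<close>
  have lim_any: "(\<lambda>n. \<phi> (f n)) \<longlonglongrightarrow> l g" if g: "g \<in> E" and f: "(\<lambda>n. N (g - J (f n))) \<longlonglongrightarrow> 0" for f g
  proof -
    have "(\<lambda>n. \<bar>C\<bar> * (N (g - J (f n)) + N (g - J (p g n)))) \<longlonglongrightarrow> 0"
      using tendsto_mult_right_zero[OF tendsto_add[OF f p_lim[OF g], simplified]] .
    then have "(\<lambda>n. \<phi> (f n) - \<phi> (p g n)) \<longlonglongrightarrow> 0"
      by (rule Lim_null_comparison[rotated]) (use bound'[OF g] in auto)
    from tendsto_add[OF this conv[OF g]] show ?thesis by simp
  qed
  have lJ: "l (J f) = \<phi> f" for f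
    using lim_any[OF JE, of f "\<lambda>_. f"] by (simp add: LIMSEQ_const_iff)
  have "l (u + v) = l u + l v" if uv: "u \<in> E" "v \<in> E" for u v
  proof -
    have "(\<lambda>n. N (u + v - J (p u n + p v n))) \<longlonglongrightarrow> 0"
    proof (rule tendsto_sandwich[OF _ _ tendsto_const
          tendsto_add[OF p_lim[OF uv(1)] p_lim[OF uv(2)], simplified]])
      show "\<forall>\<^sub>F n in sequentially. 0 \<le> N (u + v - J (p u n + p v n))"
        using uv JE subspace_diff[OF subspace] subspace_add[OF subspace]
        by (intro always_eventually allI N_nonneg) auto
      have "N (u + v - J (p u n + p v n)) \<le> N (u - J (p u n)) + N (v - J (p v n))" for n
        using triangle[of "u - J (p u n)" "v - J (p v n)"] uv JE subspace_diff[OF subspace]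
        by (simp add: linear_add[OF J(1)] algebra_simps)
      then show "\<forall>\<^sub>F n in sequentially. N (u + v - J (p u n + p v n))
          \<le> N (u - J (p u n)) + N (v - J (p v n))" by simp
    qed
    from lim_any[OF _ this] uv subspace_add[OF subspace]
    have "(\<lambda>n. \<phi> (p u n + p v n)) \<longlonglongrightarrow> l (u + v)" by auto
    moreover have "(\<lambda>n. \<phi> (p u n + p v n)) \<longlonglongrightarrow> l u + l v"
      unfolding linear_add[OF \<phi>] using conv uv by (intro tendsto_add)
    ultimately show ?thesis by (rule LIMSEQ_unique)
  qed
  moreover have "l (c *\<^sub>R v) = c * l v" if v: "v \<in> E" for c v
  proof -
    have "N (c *\<^sub>R v - J (c *\<^sub>R p v n)) = \<bar>c\<bar> * N (v - J (p v n))" for n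
      using homogeneous[of "v - J (p v n)" c] v JE subspace_diff[OF subspace]
      by (simp add: linear_scale[OF J(1)] algebra_simps)
    then have "(\<lambda>n. N (c *\<^sub>R v - J (c *\<^sub>R p v n))) \<longlonglongrightarrow> 0"
      using tendsto_mult_right_zero[OF p_lim[OF v]] by simp
    from lim_any[OF _ this] v subspace_scale[OF subspace]
    have "(\<lambda>n. \<phi> (c *\<^sub>R p v n)) \<longlonglongrightarrow> l (c *\<^sub>R v)" by auto
    moreover have "(\<lambda>n. \<phi> (c *\<^sub>R p v n)) \<longlonglongrightarrow> c * l v"
      unfolding linear_scale[OF \<phi>] using conv[OF v] by (auto intro: tendsto_mult_left)
    ultimately show ?thesis by (rule LIMSEQ_unique)
  qed
  moreover have "\<bar>l v\<bar> \<le> \<bar>C\<bar> * N v" if v: "v \<in> E" for v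
  proof (rule LIMSEQ_le)
    show "(\<lambda>n. \<bar>\<phi> (p v n)\<bar>) \<longlonglongrightarrow> \<bar>l v\<bar>" by (intro tendsto_rabs conv v)
    have "(\<lambda>n. \<bar>C\<bar> * (N v + N (v - J (p v n)))) \<longlonglongrightarrow> \<bar>C\<bar> * (N v + 0)"
      by (intro tendsto_intros p_lim v)
    then show "(\<lambda>n. \<bar>C\<bar> * (N v + N (v - J (p v n)))) \<longlonglongrightarrow> \<bar>C\<bar> * N v" by simp
    show "\<exists>n0. \<forall>n\<ge>n0. \<bar>\<phi> (p v n)\<bar> \<le> \<bar>C\<bar> * (N v + N (v - J (p v n)))"
      using bound'[OF v, of _ 0] by (simp add: linear_0[OF J(1)] linear_0[OF \<phi>] add.commute)
  qed
  moreover have "l v = 0" if "v \<notin> E" for v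
    using that unfolding l_def by simp
  ultimately have l: "l \<in> dual_space E N" unfolding dual_space_def by blast
  show ?thesis
  proof (rule ex1I[of _ l])
    show "l \<in> dual_space E N \<and> (\<forall>f. l (J f) = \<phi> f)" using l lJ by blast
    fix l' assume l': "l' \<in> dual_space E N \<and> (\<forall>f. l' (J f) = \<phi> f)"
    obtain C' where C': "C' \<ge> 0" "\<And>v. v \<in> E \<Longrightarrow> \<bar>l' v\<bar> \<le> C' * N v"
      using dual_boundE l' by blast
    show "l' = l"
    proof
      fix g
      show "l' g = l g"
      proof (cases "g \<in> E")
        case True
        \<comment> \<open>A bounded \<open>l'\<close> that agrees with \<open>\<phi>\<close> on the
          range of \<open>J\<close> has the same limit along the approximants. Outside
          \<open>E\<close> both functionals vanish by the normalisation in
          \<open>dual_space\<close>.\<close>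
        have "(\<lambda>n. l' g - \<phi> (p g n)) \<longlonglongrightarrow> 0"
        proof (rule Lim_null_comparison[OF _ tendsto_mult_right_zero[OF p_lim[OF True]]])
          have "l' g - \<phi> (p g n) = l' (g - J (p g n))" for n
            using dual_diff[of l' g "J (p g n)"] l' True JE by simp
          then show "\<forall>\<^sub>F n in sequentially. norm (l' g - \<phi> (p g n)) \<le> C' * N (g - J (p g n))"
            using C'(2) True JE subspace_diff[OF subspace] by auto
        qed
        moreover have "(\<lambda>n. l' g - \<phi> (p g n)) \<longlonglongrightarrow> l' g - l g"
          by (intro tendsto_diff tendsto_const conv True)
        ultimately show ?thesis using LIMSEQ_unique by fastforce
      next
        case False
        then show ?thesis using l' unfolding dual_space_def l_def by auto
      qed
    qed
  qed
qed

end


section \<open>The K-functional\<close>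

lemma K_functional_le:
  assumes "0 \<le> t" "v = j0 a + j1 b"
  shows "K_functional j0 j1 t v \<le> norm a + t * norm b"
proof -
  have "bdd_below ((\<lambda>p. norm (fst p) + t * norm (snd p)) ` {(a, b). v = j0 a + j1 b})"
    using assms(1) by (intro bdd_belowI2[of _ 0]) auto
  from cINF_lower[OF this, of "(a, b)"] assms(2) show ?thesis
    unfolding K_functional_def by simp
qed

lemma K_functional_greatest:
  assumes "\<exists>a b. v = j0 a + j1 b"
    and "\<And>a b. v = j0 a + j1 b \<Longrightarrow> c \<le> norm a + t * norm b"
  shows "c \<le> K_functional j0 j1 t v"
  unfolding K_functional_def using assms by (intro cINF_greatest) auto

lemma K_functional_nonneg:
  assumes "0 \<le> t" "\<exists>a b. v = j0 a + j1 b"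
  shows "0 \<le> K_functional j0 j1 t v"
  using assms by (intro K_functional_greatest) auto

lemma K_functional_decomp:
  assumes "\<exists>a b. v = j0 a + j1 b" "K_functional j0 j1 t v < c"
  obtains a b where "v = j0 a + j1 b" "norm a + t * norm b < c"
proof (rule ccontr)
  assume "\<not> thesis"
  then have "c \<le> K_functional j0 j1 t v"
    using that not_less by (intro K_functional_greatest assms(1)) blast
  with assms(2) show False by simp
qed

lemma K_functional_add_le:
  assumes "linear j0" "linear j1" "0 \<le> t"
    and u: "\<exists>a b. u = j0 a + j1 b" and v: "\<exists>a b. v = j0 a + j1 b"
  shows "K_functional j0 j1 t (u + v) \<le> K_functional j0 j1 t u + K_functional j0 j1 t v"
proof -
  \<comment> \<open>The two infima are taken one after the other: first over the splittings of
    \<open>v\<close> with that of \<open>u\<close> fixed, then over those of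
    \<open>u\<close>.\<close>
  have 1: "K_functional j0 j1 t (u + v) - (norm a + t * norm b) \<le> K_functional j0 j1 t v"
    if ab: "u = j0 a + j1 b" for a b
  proof (rule K_functional_greatest[OF v])
    fix c d assume cd: "v = j0 c + j1 d"
    have "K_functional j0 j1 t (u + v) \<le> norm (a + c) + t * norm (b + d)"
      using assms(3) by (rule K_functional_le) (simp add: ab cd linear_add[OF assms(1)] linear_add[OF assms(2)])
    also have "\<dots> \<le> (norm a + norm c) + t * (norm b + norm d)"
      using assms(3) by (intro add_mono mult_left_mono norm_triangle_ineq)
    finally show "K_functional j0 j1 t (u + v) - (norm a + t * norm b) \<le> norm c + t * norm d"
      by (simp add: algebra_simps)
  qed
  have "K_functional j0 j1 t (u + v) - K_functional j0 j1 t v \<le> K_functional j0 j1 t u"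
    using 1 by (intro K_functional_greatest[OF u]) (simp add: algebra_simps)
  then show ?thesis by simp
qed

lemma K_functional_scaleR_le:
  assumes "linear j0" "linear j1" "0 \<le> t" and v: "\<exists>a b. v = j0 a + j1 b"
  shows "K_functional j0 j1 t (c *\<^sub>R v) \<le> \<bar>c\<bar> * K_functional j0 j1 t v"
proof (cases "c = 0")
  case True
  then show ?thesis
    using K_functional_le[of t "0 *\<^sub>R v" j0 0 j1 0] assms(3)
    by (simp add: linear_0[OF assms(1)] linear_0[OF assms(2)])
next
  case False
  have "K_functional j0 j1 t (c *\<^sub>R v) / \<bar>c\<bar> \<le> K_functional j0 j1 t v"
  proof (rule K_functional_greatest[OF v])
    fix a b assume ab: "v = j0 a + j1 b"
    have "K_functional j0 j1 t (c *\<^sub>R v) \<le> norm (c *\<^sub>R a) + t * norm (c *\<^sub>R b)"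
      using assms(3) by (rule K_functional_le)
        (simp add: ab linear_scale[OF assms(1)] linear_scale[OF assms(2)] scaleR_add_right)
    then show "K_functional j0 j1 t (c *\<^sub>R v) / \<bar>c\<bar> \<le> norm a + t * norm b"
      using False by (simp add: field_simps)
  qed
  with False show ?thesis by (simp add: field_simps)
qed

lemma K_functional_scaleR:
  assumes "linear j0" "linear j1" "0 \<le> t" and v: "\<exists>a b. v = j0 a + j1 b"
  shows "K_functional j0 j1 t (c *\<^sub>R v) = \<bar>c\<bar> * K_functional j0 j1 t v"
proof (cases "c = 0")
  case True
  have "0 \<le> K_functional j0 j1 t (0 *\<^sub>R v)"
    using assms(3) by (intro K_functional_nonneg exI[of _ 0])
      (simp_all add: linear_0[OF assms(1)] linear_0[OF assms(2)])
  with K_functional_scaleR_le[OF assms, of 0] True show ?thesis by simp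
next
  case False
  obtain a b where "v = j0 a + j1 b" using v by blast
  then have "c *\<^sub>R v = j0 (c *\<^sub>R a) + j1 (c *\<^sub>R b)"
    by (simp add: linear_scale[OF assms(1)] linear_scale[OF assms(2)] scaleR_add_right)
  \<comment> \<open>The reverse inequality is the same estimate for the scalar
    \<open>inverse c\<close> and the vector \<open>c *\<^sub>R v\<close>.\<close>
  then have "K_functional j0 j1 t (inverse c *\<^sub>R c *\<^sub>R v)
      \<le> \<bar>inverse c\<bar> * K_functional j0 j1 t (c *\<^sub>R v)"
    by (intro K_functional_scaleR_le assms(1-3)) blast
  with False have "\<bar>c\<bar> * K_functional j0 j1 t v \<le> K_functional j0 j1 t (c *\<^sub>R v)"
    by (simp add: field_simps)
  with K_functional_scaleR_le[OF assms] show ?thesis by (meson order_antisym)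
qed

lemma K_functional_mono:
  assumes "0 \<le> s" "s \<le> t" and v: "\<exists>a b. v = j0 a + j1 b"
  shows "K_functional j0 j1 s v \<le> K_functional j0 j1 t v"
proof (rule K_functional_greatest[OF v])
  fix a b assume "v = j0 a + j1 b"
  then have "K_functional j0 j1 s v \<le> norm a + s * norm b"
    using assms(1) by (intro K_functional_le)
  also have "\<dots> \<le> norm a + t * norm b" using assms(2) by (simp add: mult_right_mono)
  finally show "K_functional j0 j1 s v \<le> norm a + t * norm b" .
qed

text \<open>This says that \<open>K t / t\<close> is nonincreasing: multiplying the cost of a
  splitting at level \<open>t\<close> by \<open>s / t \<le> 1\<close> leaves at most its cost at
  level \<open>s\<close>. It will give \<open>K (2 * s) \<le> 2 * K s\<close>.\<close>

lemma K_functional_antimono_div: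
  assumes "0 \<le> s" "s \<le> t" and v: "\<exists>a b. v = j0 a + j1 b"
  shows "s * K_functional j0 j1 t v \<le> t * K_functional j0 j1 s v"
proof (cases "t = 0")
  case True
  then show ?thesis using assms(1,2) by simp
next
  case False
  then have t: "t > 0" using assms by simp
  have "(s / t) * K_functional j0 j1 t v \<le> K_functional j0 j1 s v"
  proof (rule K_functional_greatest[OF v])
    fix a b assume "v = j0 a + j1 b"
    then have "(s / t) * K_functional j0 j1 t v \<le> (s / t) * (norm a + t * norm b)"
      using assms(1) t by (intro mult_left_mono K_functional_le) auto
    also have "\<dots> = (s / t) * norm a + s * norm b" using t by (simp add: algebra_simps)
    also have "(s / t) * norm a \<le> 1 * norm a"
      using t assms(2) by (intro mult_right_mono) auto
    finally show "(s / t) * K_functional j0 j1 t v \<le> norm a + s * norm b" by simp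
  qed
  with t show ?thesis by (simp add: field_simps)
qed

section \<open>Interpolation norms in terms of the K-functional\<close>

text \<open>A monotone function is Borel. Monotonicity in \<open>t\<close> is available for
  nonnegative \<open>t\<close> only, hence the detour through \<open>max t 0\<close>, which the
  indicator makes harmless.\<close>

lemma K_functional_measurable:
  assumes v: "\<exists>a b. v = j0 a + j1 b"
  shows "(\<lambda>t. ennreal (t powr (-\<theta>) * K_functional j0 j1 t v / t) * indicator {0<..} t)
           \<in> borel_measurable lborel"
proof -
  have "mono (\<lambda>t. K_functional j0 j1 (max t 0) v)"
    by (intro monoI K_functional_mono v) auto
  then have [measurable]: "(\<lambda>t. K_functional j0 j1 (max t 0) v) \<in> borel_measurable borel"
    by (rule borel_measurable_mono)
  have "(\<lambda>t. ennreal (t powr (-\<theta>) * K_functional j0 j1 t v / t) * indicator {0<..} t)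
      = (\<lambda>t. ennreal (t powr (-\<theta>) * K_functional j0 j1 (max t 0) v / t) * indicator {0<..} t)"
    by (auto simp: fun_eq_iff indicator_def max_def)
  also have "\<dots> \<in> borel_measurable lborel" by measurable
  finally show ?thesis .
qed

lemma interp_ennorm_one:
  assumes v: "\<exists>a b. v = j0 a + j1 b"
  shows "interp_ennorm j0 j1 \<theta> 1 v
    = (\<integral>\<^sup>+t\<in>{0<..}. ennreal (t powr (-\<theta>) * K_functional j0 j1 t v / t) \<partial>lborel)"
proof -
  have "(\<integral>\<^sup>+t\<in>{0<..}. ennreal ((t powr (-\<theta>) * K_functional j0 j1 t v) powr enn2real 1 / t) \<partial>lborel)
    = (\<integral>\<^sup>+t\<in>{0<..}. ennreal (t powr (-\<theta>) * K_functional j0 j1 t v / t) \<partial>lborel)"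
    by (intro nn_integral_cong) (auto simp: indicator_def K_functional_nonneg[OF _ v] less_imp_le)
  then show ?thesis
    unfolding interp_ennorm_def Let_def by (auto simp: less_top)
qed

lemma interp_space_infinity_decomp:
  assumes "v \<in> interp_space j0 j1 \<theta> \<infinity>"
  obtains M where "M > 0"
    "\<And>t. t > 0 \<Longrightarrow> \<exists>a b. v = j0 a + j1 b \<and> norm a + t * norm b \<le> M * t powr \<theta>"
proof -
  let ?S = "interp_ennorm j0 j1 \<theta> \<infinity> v"
  have v: "\<exists>a b. v = j0 a + j1 b" and fin: "?S < \<infinity>"
    using assms unfolding interp_space_def by auto
  \<comment> \<open>The added 1 makes the bound on the K-functional strict, so that an actual
    splitting satisfies it, and keeps \<open>M\<close> positive.\<close>
  define M where "M = enn2real ?S + 1"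
  have "\<exists>a b. v = j0 a + j1 b \<and> norm a + t * norm b \<le> M * t powr \<theta>" if t: "t > 0" for t
  proof -
    have "ennreal (t powr (-\<theta>) * K_functional j0 j1 t v) \<le> ?S"
      unfolding interp_ennorm_def using t by (auto intro: SUP_upper)
    also have "?S = ennreal (enn2real ?S)" using fin by simp
    finally have "t powr (-\<theta>) * K_functional j0 j1 t v \<le> enn2real ?S"
      by (simp add: ennreal_le_iff)
    then have "t powr (-\<theta>) * K_functional j0 j1 t v < M" unfolding M_def by simp
    then have "K_functional j0 j1 t v < M * t powr \<theta>"
      using t by (simp add: powr_minus field_simps)
    then show ?thesis using K_functional_decomp[OF v] less_imp_le by metis
  qed
  moreover have "M > 0" unfolding M_def using enn2real_nonneg[of ?S] by linarith
  ultimately show ?thesis using that by blast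
qed

text \<open>Near 0 the bound \<open>t * B\<close> leaves \<open>t powr (-\<theta>)\<close>,
  integrable since \<open>\<theta> < 1\<close>; near infinity the bound \<open>A\<close> leaves
  \<open>t powr (-\<theta> - 1)\<close>, integrable since \<open>\<theta> > 0\<close>.\<close>

lemma nn_integral_min_powr_finite:
  fixes A B \<theta> :: real
  assumes "0 < \<theta>" "\<theta> < 1" "A \<ge> 0" "B \<ge> 0"
  shows "(\<integral>\<^sup>+t\<in>{0<..}. ennreal (t powr (-\<theta>) * min A (t * B) / t) \<partial>lborel) < \<infinity>"
proof -
  have 1: "(\<integral>\<^sup>+t. ennreal (t powr (-\<theta>)) * indicator {0..1} t \<partial>lborel) = ennreal (1 powr (-\<theta> + 1) / (-\<theta> + 1))"
    using assms by (intro nn_integral_has_integral_lebesgue' has_integral_powr_from_0) auto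
  have 2: "(\<integral>\<^sup>+t. ennreal (t powr (-\<theta> - 1)) * indicator {1..} t \<partial>lborel)
      = ennreal (- (1 powr (-\<theta> - 1 + 1)) / (-\<theta> - 1 + 1))"
    using assms by (intro nn_integral_has_integral_lebesgue' has_integral_powr_to_inf) auto
  have "(\<integral>\<^sup>+t\<in>{0<..}. ennreal (t powr (-\<theta>) * min A (t * B) / t) \<partial>lborel)
    \<le> (\<integral>\<^sup>+t. ennreal B * (ennreal (t powr (-\<theta>)) * indicator {0..1} t)
          + ennreal A * (ennreal (t powr (-\<theta> - 1)) * indicator {1..} t) \<partial>lborel)"
  proof (rule nn_integral_mono)
    fix t :: real
    have "ennreal (t powr (-\<theta>) * min A (t * B) / t) \<le> ennreal (B * t powr (-\<theta>))"
      if "0 < t"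
    proof (rule ennreal_leI)
      have "t powr (-\<theta>) * min A (t * B) / t \<le> t powr (-\<theta>) * (t * B) / t"
        using that by (intro divide_right_mono mult_left_mono) auto
      then show "t powr (-\<theta>) * min A (t * B) / t \<le> B * t powr (-\<theta>)"
        using that by (simp add: algebra_simps)
    qed
    moreover have "ennreal (t powr (-\<theta>) * min A (t * B) / t) \<le> ennreal (A * t powr (-\<theta> - 1))"
      if "0 < t"
    proof (rule ennreal_leI)
      have "t powr (-\<theta>) * min A (t * B) / t \<le> t powr (-\<theta>) * A / t"
        using that by (intro divide_right_mono mult_left_mono) auto
      then show "t powr (-\<theta>) * min A (t * B) / t \<le> A * t powr (-\<theta> - 1)"
        using that by (simp add: algebra_simps powr_diff)
    qed
    ultimately show "ennreal (t powr (-\<theta>) * min A (t * B) / t) * indicator {0<..} t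
      \<le> ennreal B * (ennreal (t powr (-\<theta>)) * indicator {0..1} t)
        + ennreal A * (ennreal (t powr (-\<theta> - 1)) * indicator {1..} t)"
      using assms(3,4)
      by (auto simp: indicator_def ennreal_mult'' ennreal_mult' intro: add_increasing2)
  qed
  also have "\<dots> = ennreal B * (\<integral>\<^sup>+t. ennreal (t powr (-\<theta>)) * indicator {0..1} t \<partial>lborel)
      + ennreal A * (\<integral>\<^sup>+t. ennreal (t powr (-\<theta> - 1)) * indicator {1..} t \<partial>lborel)"
    by (simp add: nn_integral_add nn_integral_cmult)
  also have "\<dots> < \<infinity>"
    unfolding 1 2 by (simp add: ennreal_mult_less_top)
  finally show ?thesis .
qed


section \<open>The dual couple\<close>

locale dual_couple =
  fixes \<iota> :: "'d::real_normed_vector \<Rightarrow>\<^sub>L 'x::real_normed_vector" and \<theta> :: real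
  assumes \<theta>: "0 < \<theta>" "\<theta> < 1"
begin

abbreviation J :: "('x \<Rightarrow>\<^sub>L real) \<Rightarrow> ('d \<Rightarrow>\<^sub>L real)" where
  "J \<equiv> dual_embedding \<iota>"

abbreviation K :: "real \<Rightarrow> ('d \<Rightarrow>\<^sub>L real) \<Rightarrow> real" where
  "K \<equiv> K_functional J (\<lambda>g. g)"

abbreviation Z :: "('d \<Rightarrow>\<^sub>L real) set" where "Z \<equiv> Z_space \<iota> \<theta>"
abbreviation N :: "('d \<Rightarrow>\<^sub>L real) \<Rightarrow> real" where "N \<equiv> Z_norm \<iota> \<theta>"

text \<open>The integrand of the \<open>Z\<close>-norm. With values in \<open>ennreal\<close>,
  subadditivity and scaling can be integrated before membership in \<open>Z\<close> is
  known.\<close>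

abbreviation w :: "('d \<Rightarrow>\<^sub>L real) \<Rightarrow> real \<Rightarrow> ennreal" where
  "w g t \<equiv> ennreal (t powr (-\<theta>) * K t g / t) * indicator {0<..} t"

lemma linear_J: "linear J"
  unfolding dual_embedding_def
  by (intro linearI blinfun_eqI) (auto simp: blinfun.bilinear_simps)

lemma norm_J: "norm (J f) \<le> norm f * norm \<iota>"
  unfolding dual_embedding_def by (rule norm_blinfun_compose)

lemma decomposable: "\<exists>a b. (g :: 'd \<Rightarrow>\<^sub>L real) = J a + b"
  by (intro exI[of _ 0] exI[of _ g]) (simp add: linear_0[OF linear_J])

lemma linear_ident: "linear (\<lambda>g :: 'd \<Rightarrow>\<^sub>L real. g)"
  by (rule linear_id[unfolded id_def])

lemmas K_nonneg = K_functional_nonneg[OF _ decomposable]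
  and K_add_le = K_functional_add_le[OF linear_J linear_ident _ decomposable decomposable]
  and K_scaleR = K_functional_scaleR[OF linear_J linear_ident _ decomposable]
  and K_mono = K_functional_mono[OF _ _ decomposable]
  and K_antimono_div = K_functional_antimono_div[OF _ _ decomposable]
  and w_measurable [measurable] = K_functional_measurable[OF decomposable]

lemma K_le_norm: "0 \<le> t \<Longrightarrow> K t g \<le> t * norm g"
  using K_functional_le[of t g J 0 "\<lambda>g. g" g] by (simp add: linear_0[OF linear_J])

lemma K_J_le_norm: "0 \<le> t \<Longrightarrow> K t (J f) \<le> norm f"
  using K_functional_le[of t "J f" J f "\<lambda>g. g" 0] by simp

section \<open>The interpolation space \<open>Z\<close> as a seminormed space\<close>

lemma Z_ennorm: "interp_ennorm J (\<lambda>g. g) \<theta> 1 g = (\<integral>\<^sup>+t. w g t \<partial>lborel)"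
  by (rule interp_ennorm_one[OF decomposable])

lemma Z_iff: "g \<in> Z \<longleftrightarrow> (\<integral>\<^sup>+t. w g t \<partial>lborel) < \<infinity>"
  unfolding Z_space_def interp_space_def Z_ennorm using decomposable by auto

lemma Z_norm_eq: "N g = enn2real (\<integral>\<^sup>+t. w g t \<partial>lborel)"
  unfolding Z_norm_def interp_norm_def Z_ennorm ..

lemma ennreal_Z_norm: "g \<in> Z \<Longrightarrow> ennreal (N g) = (\<integral>\<^sup>+t. w g t \<partial>lborel)"
  unfolding Z_iff Z_norm_eq by simp

lemma w_add_le: "w (u + v) t \<le> w u t + w v t"
proof (cases "t > 0")
  case True
  have "t powr (-\<theta>) * K t (u + v) / t \<le> t powr (-\<theta>) * (K t u + K t v) / t"
    using True by (intro divide_right_mono mult_left_mono K_add_le) auto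
  also have "\<dots> = t powr (-\<theta>) * K t u / t + t powr (-\<theta>) * K t v / t"
    by (simp add: algebra_simps add_divide_distrib)
  finally show ?thesis
    using True K_nonneg[of t] by (simp flip: ennreal_plus add: ennreal_leI)
qed simp

lemma w_scaleR: "w (c *\<^sub>R v) t = ennreal \<bar>c\<bar> * w v t"
  using K_nonneg[of t v] by (cases "t > 0") (auto simp: K_scaleR algebra_simps simp flip: ennreal_mult')

lemma nn_integral_w_add:
  "(\<integral>\<^sup>+t. w (u + v) t \<partial>lborel) \<le> (\<integral>\<^sup>+t. w u t \<partial>lborel) + (\<integral>\<^sup>+t. w v t \<partial>lborel)"
  by (subst nn_integral_add[symmetric]) (auto intro: nn_integral_mono w_add_le)

lemma nn_integral_w_scaleR:
  "(\<integral>\<^sup>+t. w (c *\<^sub>R v) t \<partial>lborel) = ennreal \<bar>c\<bar> * (\<integral>\<^sup>+t. w v t \<partial>lborel)"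
  unfolding w_scaleR by (rule nn_integral_cmult) measurable

sublocale Z: seminorm_on Z N
proof
  have "0 \<in> Z"
    using nn_integral_w_scaleR[of 0 0] unfolding Z_iff by simp
  moreover have add: "u + v \<in> Z" if "u \<in> Z" "v \<in> Z" for u v
    using that order_le_less_trans[OF nn_integral_w_add] unfolding Z_iff by simp
  moreover have "c *\<^sub>R v \<in> Z" if "v \<in> Z" for c v
    using that unfolding Z_iff nn_integral_w_scaleR by (simp add: ennreal_mult_less_top)
  ultimately show "subspace Z" unfolding subspace_def by blast
  show "N (u + v) \<le> N u + N v" if "u \<in> Z" "v \<in> Z" for u v
  proof -
    have "ennreal (N (u + v)) \<le> ennreal (N u) + ennreal (N v)"
      using nn_integral_w_add add[OF that] that by (simp add: ennreal_Z_norm)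
    then show ?thesis
      by (simp add: Z_norm_eq ennreal_le_iff flip: ennreal_plus)
  qed
  show "N (c *\<^sub>R v) = \<bar>c\<bar> * N v" if "v \<in> Z" for c v
    unfolding Z_norm_eq nn_integral_w_scaleR by (simp add: enn2real_mult)
qed

text \<open>The two trivial splittings of \<open>J f\<close> bound its K-functional by
  \<open>min (norm f) (t * norm (J f))\<close>, whose weighted integral is finite.\<close>

lemma J_in_Z: "J f \<in> Z"
proof -
  have "(\<integral>\<^sup>+t. w (J f) t \<partial>lborel)
    \<le> (\<integral>\<^sup>+t\<in>{0<..}. ennreal (t powr (-\<theta>) * min (norm f) (t * norm (J f)) / t) \<partial>lborel)"
    by (intro nn_integral_mono)
      (auto simp: indicator_def intro!: ennreal_leI divide_right_mono mult_left_mono K_J_le_norm K_le_norm)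
  also have "\<dots> < \<infinity>"
    using \<theta> by (intro nn_integral_min_powr_finite) auto
  finally show ?thesis unfolding Z_iff .
qed

section \<open>Dyadic discretisation of the \<open>Z\<close>-norm\<close>

text \<open>On \<open>{s..<2 * s}\<close> the K-functional is at least \<open>K s g\<close> and the
  weight at least its value at \<open>2 * s\<close>. The interval has length \<open>s\<close>, which
  leaves the factor \<open>2 powr (1 + \<theta>)\<close>.\<close>

lemma K_interval_le:
  assumes s: "s > 0"
  shows "ennreal (s powr (-\<theta>) * K s g)
    \<le> ennreal (2 powr (1 + \<theta>)) * (\<integral>\<^sup>+t\<in>{s..<2 * s}. w g t \<partial>lborel)"
proof -
  let ?c = "(2 * s) powr (-\<theta>) * K s g / (2 * s)"
  have c: "?c \<ge> 0" using s K_nonneg[of s g] by simp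
  have "ennreal (?c * s) = (\<integral>\<^sup>+t. ennreal ?c * indicator {s..<2 * s} t \<partial>lborel)"
    using s c by (simp add: nn_integral_cmult_indicator ennreal_mult del: times_divide_eq_left)
  also have "\<dots> \<le> (\<integral>\<^sup>+t\<in>{s..<2 * s}. w g t \<partial>lborel)"
  proof (intro nn_integral_mono)
    fix t
    have "?c \<le> t powr (-\<theta>) * K t g / t" if "s \<le> t" "t < 2 * s"
      using that s \<theta> K_nonneg[of s g] K_nonneg[of t g]
      by (intro frac_le mult_mono K_mono mult_nonneg_nonneg powr_mono2') auto
    then show "ennreal ?c * indicator {s..<2 * s} t \<le> w g t * indicator {s..<2 * s} t"
      using s by (auto simp: indicator_def intro: ennreal_leI)
  qed
  finally have "ennreal (2 powr (1 + \<theta>)) * ennreal (?c * s)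
    \<le> ennreal (2 powr (1 + \<theta>)) * (\<integral>\<^sup>+t\<in>{s..<2 * s}. w g t \<partial>lborel)"
    by (rule mult_left_mono) simp
  also have "ennreal (2 powr (1 + \<theta>)) * ennreal (?c * s) = ennreal (2 powr (1 + \<theta>) * (?c * s))"
    using c s by (simp add: ennreal_mult del: times_divide_eq_left)
  also have "2 powr (1 + \<theta>) * (?c * s) = s powr (-\<theta>) * K s g"
    using s by (simp add: powr_mult powr_add powr_minus field_simps)
  finally show ?thesis .
qed

text \<open>The half-open dyadic intervals are disjoint, so the local bounds add up to one integral.
  The bound depends neither on the starting level \<open>s\<close> nor on the number
  \<open>m\<close> of levels.\<close>

lemma dyadic_sum_le:
  assumes s: "s > 0" and g: "g \<in> Z"
  shows "(\<Sum>j<m. (s * 2 ^ j) powr (-\<theta>) * K (s * 2 ^ j) g) \<le> 2 powr (1 + \<theta>) * N g"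
proof -
  let ?a = "\<lambda>j. (s * 2 ^ j) powr (-\<theta>) * K (s * 2 ^ j) g"
  have a: "0 \<le> ?a j" for j using s by (simp add: K_nonneg)
  have "ennreal (\<Sum>j<m. ?a j) \<le> ennreal (2 powr (1 + \<theta>)) * (\<integral>\<^sup>+t\<in>{s..<s * 2 ^ m}. w g t \<partial>lborel)"
  proof (induction m)
    case (Suc m)
    have s2: "s \<le> s * 2 ^ m" "s * 2 ^ m \<le> 2 * (s * 2 ^ m)"
      using s by simp_all
    have "ennreal (\<Sum>j<Suc m. ?a j) = ennreal (\<Sum>j<m. ?a j) + ennreal (?a m)"
      using a by (simp add: sum_nonneg)
    also have "\<dots> \<le> ennreal (2 powr (1 + \<theta>)) * (\<integral>\<^sup>+t\<in>{s..<s * 2 ^ m}. w g t \<partial>lborel)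
        + ennreal (2 powr (1 + \<theta>)) * (\<integral>\<^sup>+t\<in>{s * 2 ^ m..<2 * (s * 2 ^ m)}. w g t \<partial>lborel)"
      using s by (intro add_mono Suc.IH K_interval_le) simp
    also have "\<dots> = ennreal (2 powr (1 + \<theta>)) * (\<integral>\<^sup>+t\<in>{s..<s * 2 ^ m} \<union> {s * 2 ^ m..<2 * (s * 2 ^ m)}. w g t \<partial>lborel)"
      by (subst nn_integral_disjoint_pair) (auto simp: distrib_left)
    also have "{s..<s * 2 ^ m} \<union> {s * 2 ^ m..<2 * (s * 2 ^ m)} = {s..<s * 2 ^ Suc m}"
      using ivl_disj_un_two(3)[OF s2] by (simp add: algebra_simps)
    finally show ?case .
  qed simp
  also have "\<dots> \<le> ennreal (2 powr (1 + \<theta>)) * (\<integral>\<^sup>+t. w g t \<partial>lborel)"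
    by (intro mult_left_mono nn_integral_mono) (auto simp: indicator_def)
  also have "\<dots> = ennreal (2 powr (1 + \<theta>) * N g)"
    using Z.N_nonneg[OF g] by (simp add: ennreal_mult flip: ennreal_Z_norm[OF g])
  finally show ?thesis
    using Z.N_nonneg[OF g] by (simp add: ennreal_le_iff)
qed

text \<open>The dyadic sum with a single term; it says that \<open>Z\<close> embeds into the
  interpolation space with exponent infinity.\<close>

lemma K_le_Z_norm: "s > 0 \<Longrightarrow> g \<in> Z \<Longrightarrow> K s g \<le> 2 powr (1 + \<theta>) * N g * s powr \<theta>"
  using dyadic_sum_le[of s g 1] by (simp add: powr_minus field_simps)

section \<open>Near-optimal splittings and density of the dual of \<open>X\<close>\<close>

text \<open>Any splitting costs at least a fixed multiple of \<open>norm g\<close>, because both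
  components embed continuously into the dual of \<open>D\<close>. Positivity makes
  \<open>2 * K t g\<close> strictly larger than the infimum \<open>K t g\<close>.\<close>

lemma K_pos:
  assumes "t > 0" "g \<noteq> 0"
  shows "K t g > 0"
proof -
  have "norm g / (1 + norm \<iota> + 1 / t) \<le> K t g"
  proof (rule K_functional_greatest[OF decomposable])
    fix a b assume g: "g = J a + b"
    have "norm g \<le> norm \<iota> * norm a + (1 / t) * (t * norm b)"
      using norm_triangle_ineq[of "J a" b] norm_J[of a] assms(1) unfolding g by (simp add: mult.commute)
    also have "\<dots> \<le> (1 + norm \<iota> + 1 / t) * norm a + (1 + norm \<iota> + 1 / t) * (t * norm b)"
      using assms(1) by (intro add_mono mult_right_mono) auto
    finally have "norm g \<le> (1 + norm \<iota> + 1 / t) * (norm a + t * norm b)"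
      by (simp add: algebra_simps)
    moreover have "1 + norm \<iota> + 1 / t > 0" using assms(1) by (simp add: add_pos_nonneg)
    ultimately show "norm g / (1 + norm \<iota> + 1 / t) \<le> norm a + t * norm b"
      by (simp add: divide_le_eq mult.commute)
  qed
  moreover have "norm g / (1 + norm \<iota> + 1 / t) > 0"
    using assms by (intro divide_pos_pos) (auto simp: add_pos_nonneg)
  ultimately show ?thesis by linarith
qed

lemma near_optimal:
  assumes "t > 0"
  obtains f where "norm f \<le> 2 * K t g" "t * norm (g - J f) \<le> 2 * K t g"
proof (cases "g = 0")
  case True
  then show ?thesis using that[of 0] assms K_nonneg[of t g] by (simp add: linear_0[OF linear_J])
next
  case False
  then have "K t g < 2 * K t g" using K_pos[OF assms] by simp
  from K_functional_decomp[OF decomposable this] obtain a b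
    where "g = J a + b" "norm a + t * norm b < 2 * K t g" .
  moreover from this(1) have "g - J a = b" by simp
  moreover have "0 \<le> t * norm b" using assms by simp
  ultimately show ?thesis
    using that[of a] norm_ge_zero[of a] by (smt (verit))
qed

text \<open>
  The error of a near-optimal splitting at level \<open>s\<close> has a K-functional of at most
  \<open>3 K(t, g)\<close>, so that dominated convergence applies as \<open>s \<rightarrow> \<infinity>\<close>.
\<close>

lemma J_dense:
  assumes g: "g \<in> Z" and \<epsilon>: "\<epsilon> > 0"
  shows "\<exists>f. N (g - J f) < \<epsilon>"
proof -
  have "\<exists>f. norm f \<le> 2 * K (real (Suc n)) g \<and> real (Suc n) * norm (g - J f) \<le> 2 * K (real (Suc n)) g" for n
    using near_optimal[of "real (Suc n)" g] by fastforce
  then obtain f where f: "\<And>n. norm (f n) \<le> 2 * K (real (Suc n)) g"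
      "\<And>n. real (Suc n) * norm (g - J (f n)) \<le> 2 * K (real (Suc n)) g"
    by metis
  define G where "G n = g - J (f n)" for n
  have G_Z: "G n \<in> Z" for n
    unfolding G_def by (intro subspace_diff[OF Z.subspace] g J_in_Z)
  have G_le: "norm (G n) \<le> 2 * (K (real (Suc n)) g / real (Suc n))" for n
    using f(2)[of n] unfolding G_def by (simp add: field_simps)
  \<comment> \<open>Up to level \<open>Suc n\<close> the norm of the error \<open>G n\<close> is
    used, and the decrease of \<open>K t g / t\<close> gives the factor 2. Beyond it,
    \<open>G n\<close> is taken as \<open>g\<close> minus the first component, which costs 1 +
    2.\<close>
  have K_G: "K t (G n) \<le> 3 * K t g" if t: "t > 0" for t n
  proof (cases "t \<le> real (Suc n)")
    case True
    have "t * K (real (Suc n)) g \<le> real (Suc n) * K t g"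
      using t True by (intro K_antimono_div) auto
    then have "t * (K (real (Suc n)) g / real (Suc n)) \<le> K t g"
      by (simp add: field_simps)
    moreover have "K t (G n) \<le> t * (2 * (K (real (Suc n)) g / real (Suc n)))"
      using t by (intro order_trans[OF K_le_norm mult_left_mono[OF G_le]]) auto
    ultimately show ?thesis using K_nonneg[OF less_imp_le[OF t], of g]
      unfolding mult.left_commute[of t 2] by linarith
  next
    case False
    have "K t (G n) \<le> K t g + K t (- J (f n))"
      using K_add_le[of t g "- J (f n)"] t unfolding G_def by simp
    also have "K t (- J (f n)) = K t (J (f n))"
      using K_scaleR[of t "-1" "J (f n)"] t by simp
    also have "K t (J (f n)) \<le> 2 * K (real (Suc n)) g"
      using K_J_le_norm[of t "f n"] f(1)[of n] t by linarith
    also have "K (real (Suc n)) g \<le> K t g" using False by (intro K_mono) auto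
    finally show ?thesis by simp
  qed
  \<comment> \<open>The growth bound \<open>K_le_Z_norm\<close> leaves the power
    \<open>\<theta> - 1 < 0\<close> of the level. As \<open>K t (G n) \<le> t * norm (G n)\<close>,
    the integrands tend to 0 pointwise.\<close>
  have G_lim: "(\<lambda>n. norm (G n)) \<longlonglongrightarrow> 0"
  proof (rule tendsto_sandwich[OF _ _ tendsto_const])
    show "\<forall>\<^sub>F n in sequentially. 0 \<le> norm (G n)" by simp
    have "norm (G n) \<le> 2 * (2 powr (1 + \<theta>) * N g) * real (Suc n) powr (\<theta> - 1)" for n
    proof -
      have "K (real (Suc n)) g / real (Suc n)
          \<le> 2 powr (1 + \<theta>) * N g * real (Suc n) powr \<theta> / real (Suc n)"
        using K_le_Z_norm[OF _ g] by (intro divide_right_mono) auto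
      then show ?thesis using G_le[of n] by (simp add: powr_diff)
    qed
    then show "\<forall>\<^sub>F n in sequentially.
        norm (G n) \<le> 2 * (2 powr (1 + \<theta>) * N g) * real (Suc n) powr (\<theta> - 1)" by simp
    have "(\<lambda>n. real (Suc n) powr (\<theta> - 1)) \<longlonglongrightarrow> 0"
      using \<theta> by (intro tendsto_neg_powr filterlim_compose[OF filterlim_real_sequentially filterlim_Suc]) auto
    then show "(\<lambda>n. 2 * (2 powr (1 + \<theta>) * N g) * real (Suc n) powr (\<theta> - 1)) \<longlonglongrightarrow> 0"
      by (rule tendsto_mult_right_zero)
  qed
  have "(\<lambda>n. \<integral>\<^sup>+t. w (G n) t \<partial>lborel) \<longlonglongrightarrow> (\<integral>\<^sup>+(t::real). 0 \<partial>lborel)"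
  proof (rule nn_integral_dominated_convergence[where w = "\<lambda>t. ennreal 3 * w g t"])
    have "w (G n) t \<le> ennreal 3 * w g t" for n t
    proof (cases "t > 0")
      case True
      have "t powr (-\<theta>) * K t (G n) / t \<le> t powr (-\<theta>) * (3 * K t g) / t"
        using True by (intro divide_right_mono mult_left_mono K_G) auto
      then have "w (G n) t \<le> ennreal (3 * (t powr (-\<theta>) * K t g / t))"
        using True by (auto intro!: ennreal_leI simp: mult.left_commute)
      also have "\<dots> = ennreal 3 * w g t"
        using True K_nonneg[of t g] by (subst ennreal_mult) auto
      finally show ?thesis .
    qed simp
    then show "\<And>n. AE t in lborel. w (G n) t \<le> ennreal 3 * w g t" by simp
    show "(\<integral>\<^sup>+t. ennreal 3 * w g t \<partial>lborel) < \<infinity>"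
      using g unfolding Z_iff by (subst nn_integral_cmult) (auto simp: ennreal_mult_less_top)
    have "(\<lambda>n. w (G n) t) \<longlonglongrightarrow> 0" for t
    proof (cases "t > 0")
      case True
      have "(\<lambda>n. K t (G n)) \<longlonglongrightarrow> 0"
        using True K_nonneg K_le_norm
        by (intro tendsto_sandwich[OF _ _ tendsto_const tendsto_mult_right_zero[OF G_lim, of t]]) auto
      then have "(\<lambda>n. ennreal (t powr (-\<theta>) * K t (G n) / t)) \<longlonglongrightarrow> ennreal 0"
        by (intro tendsto_ennrealI) (auto intro: tendsto_divide_zero tendsto_mult_right_zero)
      then show ?thesis using True by simp
    qed simp
    then show "AE t in lborel. (\<lambda>n. w (G n) t) \<longlonglongrightarrow> 0" by simp
  qed (measurable)
  then have "(\<lambda>n. ennreal (N (G n))) \<longlonglongrightarrow> ennreal 0"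
    by (simp add: ennreal_Z_norm[OF G_Z])
  then have "(\<lambda>n. N (G n)) \<longlonglongrightarrow> 0"
    using Z.N_nonneg[OF G_Z] by (subst (asm) tendsto_ennreal_iff) auto
  then have "\<forall>\<^sub>F n in sequentially. N (G n) < \<epsilon>" using \<epsilon> by (rule order_tendstoD(2))
  then show ?thesis unfolding G_def by (auto dest: eventually_happens)
qed

section \<open>Boundedness of the pairing on \<open>Z\<close>\<close>

text \<open>With first components \<open>F s\<close> of near-optimal splittings of
  \<open>J f\<close>, the value \<open>f \<psi>\<close> is a telescoping sum over dyadic levels plus
  two end terms. The end terms vanish as the lowest level tends to 0 and the highest to
  infinity.\<close>

lemma interp_functional_bounded:
  assumes \<psi>: "\<psi> \<in> interp_space (\<lambda>x. x) (blinfun_apply \<iota>) \<theta> \<infinity>"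
  shows "\<exists>C. \<forall>f. \<bar>blinfun_apply f \<psi>\<bar> \<le> C * N (J f)"
proof -
  obtain M where M: "M > 0"
    "\<And>t. t > 0 \<Longrightarrow> \<exists>a b. \<psi> = a + \<iota> b \<and> norm a + t * norm b \<le> M * t powr \<theta>"
    using interp_space_infinity_decomp[OF \<psi>] by metis
  \<comment> \<open>A splitting of \<open>\<psi>\<close> at level \<open>1 / s\<close> pairs
    \<open>u\<close> with its component in \<open>X\<close> and \<open>J u\<close> with its
    component in \<open>D\<close>; the weights match the two bounds on \<open>u\<close>.\<close>
  have pair: "\<bar>blinfun_apply u \<psi>\<bar> \<le> c * (M * s powr (-\<theta>))"
    if s: "s > 0" and u: "norm u \<le> c" "s * norm (J u) \<le> c" for u s c
  proof -
    obtain a b where ab: "\<psi> = a + \<iota> b" "norm a + (1 / s) * norm b \<le> M * (1 / s) powr \<theta>"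
      using M(2)[of "1 / s"] s by auto
    have c: "0 \<le> c" using u(1) norm_ge_zero[of u] by linarith
    have "\<bar>blinfun_apply u \<psi>\<bar> \<le> \<bar>blinfun_apply u a\<bar> + \<bar>blinfun_apply (J u) b\<bar>"
      unfolding ab(1) dual_embedding_def by (simp add: blinfun.add_right abs_triangle_ineq)
    also have "\<dots> \<le> norm u * norm a + norm (J u) * norm b"
      using norm_blinfun[of u a] norm_blinfun[of "J u" b] by simp
    also have "\<dots> \<le> c * norm a + (c / s) * norm b"
      using u s by (intro add_mono mult_right_mono) (auto simp: field_simps)
    also have "\<dots> = c * (norm a + (1 / s) * norm b)" by (simp add: algebra_simps)
    also have "\<dots> \<le> c * (M * (1 / s) powr \<theta>)" by (intro mult_left_mono ab(2) c)
    also have "(1 / s) powr \<theta> = s powr (-\<theta>)"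
      using s by (simp add: powr_divide powr_minus inverse_eq_divide)
    finally show ?thesis .
  qed
  have "\<bar>blinfun_apply f \<psi>\<bar> \<le> (6 * M * 2 powr (1 + \<theta>)) * N (J f)" for f
  proof -
    define g where "g = J f"
    have g: "g \<in> Z" unfolding g_def by (rule J_in_Z)
    have "\<forall>s. \<exists>h. s > 0 \<longrightarrow> norm h \<le> 2 * K s g \<and> s * norm (g - J h) \<le> 2 * K s g"
      using near_optimal by metis
    then obtain F where F: "\<And>s. s > 0 \<Longrightarrow> norm (F s) \<le> 2 * K s g"
      "\<And>s. s > 0 \<Longrightarrow> s * norm (g - J (F s)) \<le> 2 * K s g"
      by metis
    \<comment> \<open>The constant 6 is 2 + 4: the splitting at \<open>s\<close> costs
      \<open>2 * K s g\<close>, the one at \<open>2 * s\<close> at most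
      \<open>4 * K s g\<close>.\<close>
    have step: "\<bar>blinfun_apply (F (2 * s)) \<psi> - blinfun_apply (F s) \<psi>\<bar>
        \<le> 6 * M * (s powr (-\<theta>) * K s g)" if s: "s > 0" for s
    proof -
      have K2: "K (2 * s) g \<le> 2 * K s g"
        using K_antimono_div[of s "2 * s" g] s by simp
      have K0: "0 \<le> K s g" using s by (intro K_nonneg) simp
      have "\<bar>blinfun_apply (F (2 * s) - F s) \<psi>\<bar> \<le> (6 * K s g) * (M * s powr (-\<theta>))"
      proof (rule pair[OF s])
        show "norm (F (2 * s) - F s) \<le> 6 * K s g"
          using F(1)[of s] F(1)[of "2 * s"] norm_triangle_ineq4[of "F (2 * s)" "F s"] K2 s by linarith
        have "J (F (2 * s) - F s) = (g - J (F s)) - (g - J (F (2 * s)))"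
          by (simp add: linear_diff[OF linear_J])
        then have "norm (J (F (2 * s) - F s)) \<le> norm (g - J (F s)) + norm (g - J (F (2 * s)))"
          by (metis norm_triangle_ineq4)
        then have "s * norm (J (F (2 * s) - F s))
            \<le> s * norm (g - J (F s)) + s * norm (g - J (F (2 * s)))"
          using s by (simp flip: distrib_left)
        then show "s * norm (J (F (2 * s) - F s)) \<le> 6 * K s g"
          using F(2)[of s] F(2)[of "2 * s"] K2 K0 s by linarith
      qed
      then show ?thesis by (simp add: blinfun.diff_left mult_ac)
    qed
    \<comment> \<open>The end term at high levels decays like \<open>s powr (-\<theta>)\<close>,
      since \<open>K s (J f)\<close> stays below \<open>norm f\<close>.\<close>
    have rest: "\<bar>blinfun_apply f \<psi> - blinfun_apply (F s) \<psi>\<bar> \<le> 3 * norm f * (M * s powr (-\<theta>))"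
      if s: "s > 0" for s
    proof -
      have Kf: "K s g \<le> norm f" using K_J_le_norm[of s f] s unfolding g_def by simp
      have "\<bar>blinfun_apply (f - F s) \<psi>\<bar> \<le> (3 * norm f) * (M * s powr (-\<theta>))"
      proof (rule pair[OF s])
        show "norm (f - F s) \<le> 3 * norm f"
          using F(1)[OF s] norm_triangle_ineq4[of f "F s"] Kf by linarith
        have "J (f - F s) = g - J (F s)" by (simp add: linear_diff[OF linear_J] g_def)
        then show "s * norm (J (f - F s)) \<le> 3 * norm f"
          using F(2)[OF s] Kf norm_ge_zero[of f] by (simp only:)
      qed
      then show ?thesis by (simp add: blinfun.diff_left)
    qed
    \<comment> \<open>The end term at low levels is of order \<open>s\<close>, since
      \<open>K s g \<le> s * norm g\<close>.\<close>
    have start: "\<bar>blinfun_apply (F s) \<psi>\<bar> \<le> s * (2 * norm g * norm \<psi>)" if s: "s > 0" for s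
    proof -
      have "\<bar>blinfun_apply (F s) \<psi>\<bar> \<le> norm (F s) * norm \<psi>"
        using norm_blinfun[of "F s" \<psi>] by simp
      also have "\<dots> \<le> (2 * (s * norm g)) * norm \<psi>"
        using F(1)[OF s] K_le_norm[of s g] s by (intro mult_right_mono) auto
      finally show ?thesis by (simp add: mult_ac)
    qed
    let ?s = "\<lambda>m. (1 / 2) ^ m :: real"
    have le: "\<bar>blinfun_apply f \<psi>\<bar> \<le> 6 * M * (2 powr (1 + \<theta>) * N g)
        + ?s m * (2 * norm g * norm \<psi>) + 3 * norm f * (M * ?s m powr \<theta>)" for m
    proof -
      define p where "p j = ?s m * 2 ^ j" for j
      have p: "p j > 0" "p (Suc j) = 2 * p j" for j unfolding p_def by auto
      \<comment> \<open>After \<open>2 * m\<close> doublings the levels run from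
        \<open>(1 / 2) ^ m\<close> to \<open>2 ^ m\<close>, so both ends are controlled by the same
        \<open>m\<close>.\<close>
      define k where "k = 2 * m"
      have pk: "p k powr (-\<theta>) = ?s m powr \<theta>"
      proof -
        have "p k = inverse (?s m)"
          unfolding p_def k_def by (simp add: power_mult power2_eq_square power_mult_distrib field_simps mult_2 power_add)
        then show ?thesis by (simp add: powr_minus inverse_powr)
      qed
      have "blinfun_apply (F (p k)) \<psi> - blinfun_apply (F (p 0)) \<psi>
          = (\<Sum>j<k. blinfun_apply (F (p (Suc j))) \<psi> - blinfun_apply (F (p j)) \<psi>)"
        by (rule sum_lessThan_telescope[symmetric])
      also have "\<bar>\<dots>\<bar> \<le> (\<Sum>j<k. 6 * M * (p j powr (-\<theta>) * K (p j) g))"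
        unfolding p(2) by (intro order_trans[OF sum_abs sum_mono] step p)
      also have "\<dots> \<le> 6 * M * (2 powr (1 + \<theta>) * N g)"
        using dyadic_sum_le[OF _ g, of "?s m" k] M(1)
        unfolding p_def sum_distrib_left[symmetric] by (intro mult_left_mono) auto
      finally show ?thesis
        using rest[OF p(1), of k] start[OF p(1), of 0] unfolding pk by (simp add: p_def)
    qed
    have s_lim: "?s \<longlonglongrightarrow> 0" by (intro LIMSEQ_power_zero) simp
    have "(\<lambda>m. 6 * M * (2 powr (1 + \<theta>) * N g)
        + ?s m * (2 * norm g * norm \<psi>) + 3 * norm f * (M * ?s m powr \<theta>))
      \<longlonglongrightarrow> 6 * M * (2 powr (1 + \<theta>) * N g) + 0 * (2 * norm g * norm \<psi>) + 3 * norm f * (M * 0 powr \<theta>)"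
      using \<theta> by (intro tendsto_intros s_lim tendsto_powr') auto
    from LIMSEQ_le[OF tendsto_const this] le
    show ?thesis unfolding g_def by (simp add: mult_ac)
  qed
  then show ?thesis by blast
qed

text \<open>Density of the range of \<open>J\<close> and boundedness of evaluation at
  \<open>\<psi>\<close> yield the unique extension, so the \<open>THE\<close> in
  \<open>Z_pairing\<close> denotes it.\<close>

lemma Z_pairing_dual:
  assumes \<psi>: "\<psi> \<in> interp_space (\<lambda>x. x) (blinfun_apply \<iota>) \<theta> \<infinity>"
  shows "Z_pairing \<iota> \<theta> \<psi> \<in> dual_space Z N"
proof -
  obtain C where C: "\<And>f. \<bar>blinfun_apply f \<psi>\<bar> \<le> C * N (J f)"
    using interp_functional_bounded[OF \<psi>] by blast
  have "linear (\<lambda>f. blinfun_apply f \<psi>)"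
    by (intro linearI) (auto simp: blinfun.bilinear_simps)
  from theI'[OF Z.dual_extension[OF linear_J _ J_dense this C]] J_in_Z
  show ?thesis unfolding Z_pairing_def by blast
qed

end


section \<open>Antiderivatives and Hoelder functions\<close>

text \<open>For \<open>a \<le> b\<close> the kernel is the indicator of \<open>{a..<b}\<close>,
  otherwise minus that of \<open>{b<..a}\<close>. The sign is that of an oriented integral, so one
  formula covers switching points in any order.\<close>

lemma chi_bar_integral:
  fixes \<phi> F :: "real \<Rightarrow> real"
  assumes cont: "continuous_on UNIV \<phi>" and F: "\<And>x. (F has_real_derivative \<phi> x) (at x)"
  shows "integrable lborel (\<lambda>t. chi_bar a b t * \<phi> t)"
    and "(LINT t|lborel. chi_bar a b t * \<phi> t) = F b - F a"
proof -
  have FTC: "(LBINT x=a..b. \<phi> x) = F b - F a" for a b :: real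
    using F cont by (intro interval_integral_FTC_finite)
      (auto intro: continuous_on_subset has_vector_derivative_at_within
        simp: has_real_derivative_iff_has_vector_derivative)
  have int: "set_integrable lborel {a..b} \<phi>" for a b
    by (intro borel_integrable_atLeastAtMost' continuous_on_subset[OF cont]) auto
  have "integrable lborel (\<lambda>t. chi_bar a b t * \<phi> t)
      \<and> (LINT t|lborel. chi_bar a b t * \<phi> t) = F b - F a"
  proof (cases "a \<le> b")
    case True
    then have eq: "(\<lambda>t. chi_bar a b t * \<phi> t) = (\<lambda>t. indicat_real {a..<b} t *\<^sub>R \<phi> t)"
      by (auto simp: chi_bar_def indicator_def fun_eq_iff)
    have "set_integrable lborel {a..<b} \<phi>"
      using int[of a b] by (rule set_integrable_subset) auto
    moreover have "(LBINT x=a..b. \<phi> x) = (LBINT x:{a..<b}. \<phi> x)"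
      using True by (intro interval_integral_Ico) auto
    ultimately show ?thesis
      using FTC[of a b] unfolding eq set_integrable_def set_lebesgue_integral_def by simp
  next
    case False
    then have eq: "(\<lambda>t. chi_bar a b t * \<phi> t) = (\<lambda>t. - (indicat_real {b<..a} t *\<^sub>R \<phi> t))"
      by (auto simp: chi_bar_def indicator_def fun_eq_iff)
    have "set_integrable lborel {b<..a} \<phi>"
      using int[of b a] by (rule set_integrable_subset) auto
    moreover have "(LBINT x=b..a. \<phi> x) = (LBINT x:{b<..a}. \<phi> x)"
      using False by (intro interval_integral_Ioc) auto
    ultimately show ?thesis
      using FTC[of b a] unfolding eq set_integrable_def set_lebesgue_integral_def by simp
  qed
  then show "integrable lborel (\<lambda>t. chi_bar a b t * \<phi> t)"
    "(LINT t|lborel. chi_bar a b t * \<phi> t) = F b - F a" by auto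
qed

lemma antiderivative_UNIV:
  fixes \<phi> :: "real \<Rightarrow> real"
  assumes "continuous_on UNIV \<phi>"
  shows "\<exists>F. \<forall>x. (F has_real_derivative \<phi> x) (at x)"
proof -
  have "\<exists>F. \<forall>x::real. - \<infinity> < ereal x \<longrightarrow> ereal x < \<infinity> \<longrightarrow> (F has_vector_derivative \<phi> x) (at x)"
    using assms by (intro einterval_antiderivative) (auto simp: continuous_on_eq_continuous_at)
  then show ?thesis
    by (simp add: has_real_derivative_iff_has_vector_derivative)
qed

text \<open>Mean value theorem on either side of \<open>x\<close>. With \<open>c = \<phi> x\<close>
  it is a Taylor remainder estimate, with \<open>c = 0\<close> a Lipschitz bound.\<close>

lemma antiderivative_diff_le:
  fixes \<phi> F :: "real \<Rightarrow> real"
  assumes F: "\<And>x. (F has_real_derivative \<phi> x) (at x)"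
    and le: "\<And>t. \<bar>t - x\<bar> \<le> \<bar>y - x\<bar> \<Longrightarrow> \<bar>\<phi> t - c\<bar> \<le> m"
  shows "\<bar>F y - F x - (y - x) * c\<bar> \<le> \<bar>y - x\<bar> * m"
proof -
  consider "x = y" | "x < y" | "y < x" by linarith
  then have "\<exists>t. \<bar>t - x\<bar> \<le> \<bar>y - x\<bar> \<and> F y - F x = (y - x) * \<phi> t"
  proof cases
    case 2
    from MVT2[OF this F] obtain t where "x < t" "t < y" "F y - F x = (y - x) * \<phi> t" by blast
    then show ?thesis by (intro exI[of _ t]) auto
  next
    case 3
    from MVT2[OF this F] obtain t where "y < t" "t < x" "F x - F y = (x - y) * \<phi> t" by blast
    then show ?thesis by (intro exI[of _ t]) (auto simp: algebra_simps)
  qed auto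
  then obtain t where t: "\<bar>t - x\<bar> \<le> \<bar>y - x\<bar>" "F y - F x = (y - x) * \<phi> t" by blast
  have "\<bar>F y - F x - (y - x) * c\<bar> = \<bar>y - x\<bar> * \<bar>\<phi> t - c\<bar>"
    unfolding t(2) by (simp add: abs_mult flip: right_diff_distrib)
  also have "\<dots> \<le> \<bar>y - x\<bar> * m" by (intro mult_left_mono le t) simp
  finally show ?thesis .
qed

text \<open>A real supremum is usable only over a nonempty set with a bounded image: the zero vector
  supplies the first, the bound \<open>b\<close> the second.\<close>

lemma dual_normI:
  assumes "0 \<in> E" "N 0 \<le> 1" and le: "\<And>v. v \<in> E \<Longrightarrow> N v \<le> 1 \<Longrightarrow> \<bar>l v\<bar> \<le> b"
  shows "0 \<le> dual_norm E N l" "dual_norm E N l \<le> b"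
proof -
  have 0: "0 \<in> {v \<in> E. N v \<le> 1}" using assms(1,2) by simp
  then show "dual_norm E N l \<le> b"
    unfolding dual_norm_def using le by (intro cSUP_least) auto
  have "\<bar>l 0\<bar> \<le> dual_norm E N l"
    unfolding dual_norm_def using le by (intro cSUP_upper 0 bdd_aboveI2[of _ _ b]) auto
  then show "0 \<le> dual_norm E N l" by linarith
qed

section \<open>The Hoelder space and the constant extension\<close>

locale holder_setting = seminorm_on +
  fixes T \<alpha> :: real
  assumes T: "T > 0" and \<alpha>: "\<alpha> \<ge> 0"
begin

abbreviation Hol where "Hol \<equiv> holder_space T \<alpha> E N"
abbreviation H where "H \<equiv> holder_norm T \<alpha> N"
abbreviation V where "V \<equiv> const_ext T"

lemma clamp: "min (max t 0) T \<in> {0..T}"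
  using T by auto

lemma const_ext_in: "v \<in> Hol \<Longrightarrow> V v t \<in> E"
  unfolding holder_space_def const_ext_def using clamp by blast

lemma const_ext_add: "V (u + v) t = V u t + V v t"
  unfolding const_ext_def by simp

lemma const_ext_scaleR: "V (c *\<^sub>R v) t = c *\<^sub>R V v t"
  unfolding const_ext_def by (simp add: scaleR_fun_def)

text \<open>Both suprema in \<open>holder_norm\<close> are taken in the reals; these bounds are what
  allows each value to be compared with its supremum.\<close>

lemma holder_bounds:
  assumes v: "v \<in> Hol"
  shows "bdd_above ((\<lambda>t. N (v t)) ` {0..T})"
    and "bdd_above ((\<lambda>p. N (v (snd p) - v (fst p)) / \<bar>snd p - fst p\<bar> powr \<alpha>) `
          {(s, t). s \<in> {0..T} \<and> t \<in> {0..T} \<and> s \<noteq> t})"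
proof -
  obtain C where C: "\<forall>s\<in>{0..T}. \<forall>t\<in>{0..T}. N (v t - v s) \<le> C * \<bar>t - s\<bar> powr \<alpha>"
    using v unfolding holder_space_def by auto
  have vE: "v t \<in> E" if "t \<in> {0..T}" for t using v that unfolding holder_space_def by auto
  show "bdd_above ((\<lambda>t. N (v t)) ` {0..T})"
  proof (rule bdd_aboveI2)
    fix t assume t: "t \<in> {0..T}"
    have "N (v t) = N ((v t - v 0) + v 0)" by simp
    also have "\<dots> \<le> N (v t - v 0) + N (v 0)"
      using t T by (intro triangle subspace_diff[OF subspace] vE) auto
    also have "N (v t - v 0) \<le> C * \<bar>t - 0\<bar> powr \<alpha>"
      using T by (intro C[rule_format] t) simp
    also have "\<dots> \<le> \<bar>C\<bar> * T powr \<alpha>"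
      using t \<alpha> by (intro mult_mono powr_mono2) auto
    finally show "N (v t) \<le> \<bar>C\<bar> * T powr \<alpha> + N (v 0)" by simp
  qed
  show "bdd_above ((\<lambda>p. N (v (snd p) - v (fst p)) / \<bar>snd p - fst p\<bar> powr \<alpha>) `
          {(s, t). s \<in> {0..T} \<and> t \<in> {0..T} \<and> s \<noteq> t})"
    using C by (intro bdd_aboveI2[of _ _ C]) (auto simp: divide_le_eq)
qed

text \<open>Clamping to \<open>{0..T}\<close> is a 1-Lipschitz retraction, so the constant extension
  keeps the sup norm and the Hoelder constant.\<close>

lemma
  assumes v: "v \<in> Hol"
  shows const_ext_le: "N (V v t) \<le> H v"
    and const_ext_holder: "N (V v t - V v s) \<le> H v * \<bar>t - s\<bar> powr \<alpha>"
proof -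
  have vE: "v t \<in> E" if "t \<in> {0..T}" for t using v that unfolding holder_space_def by auto
  let ?A = "SUP t\<in>{0..T}. N (v t)"
  let ?f = "\<lambda>p. N (v (snd p) - v (fst p)) / \<bar>snd p - fst p\<bar> powr \<alpha>"
  let ?B = "SUP p\<in>{(s, t). s \<in> {0..T} \<and> t \<in> {0..T} \<and> s \<noteq> t}. ?f p"
  have A: "N (v t) \<le> ?A" if "t \<in> {0..T}" for t
    by (intro cSUP_upper that holder_bounds v)
  have B: "?f (s, t) \<le> ?B" if "s \<in> {0..T}" "t \<in> {0..T}" "s \<noteq> t" for s t
    using that by (intro cSUP_upper holder_bounds v) auto
  have "0 \<le> ?A" using A[of 0] N_nonneg[OF vE[of 0]] T by simp
  \<comment> \<open>Each summand of \<open>H v\<close> must be nonnegative before \<open>H v\<close>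
    can dominate the other one; since \<open>T > 0\<close>, the pair \<open>(0, T)\<close> is
    admissible.\<close>
  have "0 \<le> ?f (0, T)"
    using T by (auto intro!: divide_nonneg_nonneg N_nonneg subspace_diff[OF subspace] vE)
  then have "0 \<le> ?B" using B[of 0 T] T by simp
  have H: "H v = ?A + ?B" unfolding holder_norm_def ..
  show "N (V v t) \<le> H v"
    using A[OF clamp, of t] \<open>0 \<le> ?B\<close> unfolding H const_ext_def by linarith
  define s' t' where "s' = min (max s 0) T" and "t' = min (max t 0) T"
  have st: "s' \<in> {0..T}" "t' \<in> {0..T}" "\<bar>t' - s'\<bar> \<le> \<bar>t - s\<bar>"
    unfolding s'_def t'_def using clamp by (auto simp: min_def max_def)
  have "N (v t' - v s') \<le> H v * \<bar>t - s\<bar> powr \<alpha>"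
  proof (cases "s' = t'")
    case True
    then show ?thesis using H \<open>0 \<le> ?A\<close> \<open>0 \<le> ?B\<close> by simp
  next
    case False
    then have "N (v t' - v s') \<le> ?B * \<bar>t' - s'\<bar> powr \<alpha>"
      using B[OF st(1,2)] by (simp add: divide_le_eq)
    also have "\<dots> \<le> H v * \<bar>t - s\<bar> powr \<alpha>"
      using st(3) \<alpha> H \<open>0 \<le> ?A\<close> \<open>0 \<le> ?B\<close> by (intro mult_mono powr_mono2) auto
    finally show ?thesis .
  qed
  then show "N (V v t - V v s) \<le> H v * \<bar>t - s\<bar> powr \<alpha>"
    unfolding const_ext_def s'_def t'_def .
qed

lemma holder_zero: "0 \<in> Hol" "H 0 = 0"
proof -
  show "0 \<in> Hol"
    unfolding holder_space_def using subspace_0[OF subspace] by (auto intro: exI[of _ 0])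
  have "0 \<in> {0..T}" "(0, T) \<in> {(s, t). s \<in> {0..T} \<and> t \<in> {0..T} \<and> s \<noteq> t}"
    using T by auto
  then have "{0..T} \<noteq> {}" "{(s, t). s \<in> {0..T} \<and> t \<in> {0..T} \<and> s \<noteq> t} \<noteq> {}"
    by blast+
  then show "H 0 = 0" unfolding holder_norm_def by simp
qed

lemma holder_add:
  assumes u: "u \<in> Hol" and v: "v \<in> Hol"
  shows "u + v \<in> Hol"
proof -
  have E: "u t \<in> E" "v t \<in> E" if "t \<in> {0..T}" for t
    using u v that unfolding holder_space_def by auto
  have le: "N ((u + v) s - (u + v) t) \<le> N (u s - u t) + N (v s - v t)"
    and nonneg: "0 \<le> N ((u + v) s - (u + v) t)"
    if "s \<in> {0..T}" "t \<in> {0..T}" for s t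
    using triangle[of "u s - u t" "v s - v t"] E that subspace_diff[OF subspace] subspace_add[OF subspace]
    by (auto simp: algebra_simps intro!: N_nonneg)
  obtain C D where "\<forall>s\<in>{0..T}. \<forall>t\<in>{0..T}. N (u t - u s) \<le> C * \<bar>t - s\<bar> powr \<alpha>"
    "\<forall>s\<in>{0..T}. \<forall>t\<in>{0..T}. N (v t - v s) \<le> D * \<bar>t - s\<bar> powr \<alpha>"
    using u v unfolding holder_space_def by auto
  then have "N ((u + v) t - (u + v) s) \<le> (C + D) * \<bar>t - s\<bar> powr \<alpha>"
    if "s \<in> {0..T}" "t \<in> {0..T}" for s t
    using le[OF that(2,1)] that by (fastforce simp: distrib_right)
  moreover have "((\<lambda>s. N ((u + v) s - (u + v) t)) \<longlongrightarrow> 0) (at t within {0..T})" if t: "t \<in> {0..T}" for t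
  proof (rule tendsto_sandwich[OF _ _ tendsto_const])
    show "((\<lambda>s. N (u s - u t) + N (v s - v t)) \<longlongrightarrow> 0) (at t within {0..T})"
      using u v t unfolding holder_space_def by (intro tendsto_add_zero) auto
  qed (use le nonneg t in \<open>auto simp: eventually_at intro!: exI[of _ 1]\<close>)
  ultimately show ?thesis
    using u v E subspace_add[OF subspace] unfolding holder_space_def mem_Collect_eq
    by (intro conjI exI[of _ "C + D"]) auto
qed

lemma holder_scaleR:
  assumes v: "v \<in> Hol"
  shows "c *\<^sub>R v \<in> Hol"
proof -
  have E: "v t \<in> E" if "t \<in> {0..T}" for t
    using v that unfolding holder_space_def by auto
  have eq: "N ((c *\<^sub>R v) s - (c *\<^sub>R v) t) = \<bar>c\<bar> * N (v s - v t)"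
    if "s \<in> {0..T}" "t \<in> {0..T}" for s t
    using homogeneous[of "v s - v t" c] E that subspace_diff[OF subspace]
    by (simp add: scaleR_fun_def scaleR_diff_right)
  obtain C where C: "\<forall>s\<in>{0..T}. \<forall>t\<in>{0..T}. N (v t - v s) \<le> C * \<bar>t - s\<bar> powr \<alpha>"
    using v unfolding holder_space_def by auto
  then have "\<forall>s\<in>{0..T}. \<forall>t\<in>{0..T}. N ((c *\<^sub>R v) t - (c *\<^sub>R v) s) \<le> (\<bar>c\<bar> * C) * \<bar>t - s\<bar> powr \<alpha>"
    by (simp add: eq mult_left_mono mult.assoc)
  moreover have "((\<lambda>s. N ((c *\<^sub>R v) s - (c *\<^sub>R v) t)) \<longlongrightarrow> 0) (at t within {0..T})" if t: "t \<in> {0..T}" for t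
  proof -
    have "((\<lambda>s. \<bar>c\<bar> * N (v s - v t)) \<longlongrightarrow> 0) (at t within {0..T})"
      using v t unfolding holder_space_def by (intro tendsto_mult_right_zero) auto
    moreover have "\<forall>\<^sub>F s in at t within {0..T}. \<bar>c\<bar> * N (v s - v t) = N ((c *\<^sub>R v) s - (c *\<^sub>R v) t)"
      using eq t by (auto simp: eventually_at intro!: exI[of _ 1])
    ultimately show ?thesis by (rule Lim_transform_eventually)
  qed
  ultimately show ?thesis
    using v E subspace_scale[OF subspace] unfolding holder_space_def mem_Collect_eq
    by (intro conjI exI[of _ "\<bar>c\<bar> * C"]) (auto simp: scaleR_fun_def)
qed

text \<open>The continuity clause of \<open>holder_space\<close> is used rather than the Hoelder
  bound, so that the case \<open>\<alpha> = 0\<close> is included.\<close>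

lemma continuous_dual_const_ext:
  assumes l: "l \<in> dual_space E N" and v: "v \<in> Hol"
  shows "continuous_on UNIV (\<lambda>t. l (V v t))"
proof -
  have vE: "v t \<in> E" if "t \<in> {0..T}" for t
    using v that unfolding holder_space_def by auto
  obtain C where C: "C \<ge> 0" "\<And>u. u \<in> E \<Longrightarrow> \<bar>l u\<bar> \<le> C * N u"
    using dual_boundE[OF l] by blast
  have "continuous_on {0..T} (\<lambda>t. l (v t))"
    unfolding continuous_on_def
  proof
    fix t assume t: "t \<in> {0..T}"
    have "((\<lambda>s. l (v s) - l (v t)) \<longlongrightarrow> 0) (at t within {0..T})"
    proof (rule Lim_null_comparison)
      show "((\<lambda>s. C * N (v s - v t)) \<longlongrightarrow> 0) (at t within {0..T})"
        using v t unfolding holder_space_def by (intro tendsto_mult_right_zero) auto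
      have "\<bar>l (v s) - l (v t)\<bar> \<le> C * N (v s - v t)" if "s \<in> {0..T}" for s
        using C(2)[of "v s - v t"] vE that t subspace_diff[OF subspace]
        by (simp add: dual_diff[OF l])
      then show "\<forall>\<^sub>F s in at t within {0..T}. norm (l (v s) - l (v t)) \<le> C * N (v s - v t)"
        by (auto simp: eventually_at intro!: exI[of _ 1])
    qed
    then show "((\<lambda>s. l (v s)) \<longlongrightarrow> l (v t)) (at t within {0..T})"
      by (simp add: LIM_zero_iff)
  qed
  moreover have "continuous_on UNIV (\<lambda>t. min (max t 0) T)"
    by (intro continuous_intros)
  ultimately show ?thesis
    unfolding const_ext_def by (rule continuous_on_compose2) (use clamp in auto)
qed

end


section \<open>Switching points\<close>

text \<open>The pairings with the \<open>\<psi>\<close> enter only as bounded functionals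
  \<open>l i\<close> on \<open>E\<close>, which separates the calculus in the switching points from
  interpolation theory.\<close>

locale switching = holder_setting E N T \<alpha>
  for E :: "'v::real_vector set" and N T \<alpha> +
  fixes n :: nat and e :: "nat \<Rightarrow> 'n::finite" and l :: "nat \<Rightarrow> 'v \<Rightarrow> real"
  assumes l: "i \<in> {1..n-1} \<Longrightarrow> l i \<in> dual_space E N"
begin

definition B :: "real ^ 'n \<Rightarrow> (real \<Rightarrow> 'v) \<Rightarrow> real" where
  "B \<tau> v = (if v \<in> Hol
     then LINT t|lborel. (\<Sum>i=1..n-1. chi_bar (\<tau> $ e i) (\<tau> $ e (i+1)) t * l i (V v t)) else 0)"

definition dB :: "real ^ 'n \<Rightarrow> real ^ 'n \<Rightarrow> (real \<Rightarrow> 'v) \<Rightarrow> real" where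
  "dB \<tau> h v = (\<Sum>i=1..n-1.
     l i (h $ e (i+1) *\<^sub>R V v (\<tau> $ e (i+1)) - h $ e i *\<^sub>R V v (\<tau> $ e i)))"

text \<open>The formula \<open>dB\<close> cut off outside \<open>Hol\<close>, as membership in
  \<open>dual_space\<close> requires.\<close>

definition B' :: "real ^ 'n \<Rightarrow> real ^ 'n \<Rightarrow> (real \<Rightarrow> 'v) \<Rightarrow> real" where
  "B' \<tau> h v = (if v \<in> Hol then dB \<tau> h v else 0)"

lemma l_add:
  assumes "i \<in> {1..n-1}" "u \<in> E" "v \<in> E"
  shows "l i (u + v) = l i u + l i v"
  using l[OF assms(1)] assms(2,3) unfolding dual_space_def by simp

lemma l_scale:
  assumes "i \<in> {1..n-1}" "v \<in> E"
  shows "l i (c *\<^sub>R v) = c * l i v"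
  using l[OF assms(1)] assms(2) unfolding dual_space_def by simp

lemma dB_eq:
  assumes v: "v \<in> Hol"
  shows "dB \<tau> h v = (\<Sum>i=1..n-1.
    h $ e (i+1) * l i (V v (\<tau> $ e (i+1))) - h $ e i * l i (V v (\<tau> $ e i)))"
  unfolding dB_def
proof (rule sum.cong[OF refl])
  fix i assume i: "i \<in> {1..n-1}"
  show "l i (h $ e (i+1) *\<^sub>R V v (\<tau> $ e (i+1)) - h $ e i *\<^sub>R V v (\<tau> $ e i))
    = h $ e (i+1) * l i (V v (\<tau> $ e (i+1))) - h $ e i * l i (V v (\<tau> $ e i))"
    by (simp add: dual_diff[OF l[OF i]] l_scale[OF i] subspace_scale[OF subspace] const_ext_in[OF v])
qed

text \<open>The sum of the finitely many bounds on the \<open>l i\<close> is a constant that serves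
  all indices at once.\<close>

lemma bounds:
  obtains C where "C \<ge> 0"
    "\<And>i v t. i \<in> {1..n-1} \<Longrightarrow> v \<in> Hol \<Longrightarrow> \<bar>l i (V v t)\<bar> \<le> C * H v"
    "\<And>i v s t. i \<in> {1..n-1} \<Longrightarrow> v \<in> Hol \<Longrightarrow>
        \<bar>l i (V v t) - l i (V v s)\<bar> \<le> C * (H v * \<bar>t - s\<bar> powr \<alpha>)"
proof -
  have "\<exists>C\<ge>0. \<forall>v\<in>E. \<bar>l i v\<bar> \<le> C * N v" if "i \<in> {1..n-1}" for i
    using dual_boundE[OF l[OF that]] by metis
  then obtain c where c: "\<And>i. i \<in> {1..n-1} \<Longrightarrow> 0 \<le> c i"
    "\<And>i v. i \<in> {1..n-1} \<Longrightarrow> v \<in> E \<Longrightarrow> \<bar>l i v\<bar> \<le> c i * N v"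
    by metis
  define C where "C = (\<Sum>i=1..n-1. c i)"
  have C: "C \<ge> 0" unfolding C_def by (intro sum_nonneg c)
  have le: "\<bar>l i v\<bar> \<le> C * N v" if i: "i \<in> {1..n-1}" and v: "v \<in> E" for i v
  proof -
    have "c i \<le> C" unfolding C_def by (intro member_le_sum i c) auto
    then show ?thesis
      using c(2)[OF i v] mult_right_mono[OF _ N_nonneg[OF v]] by fastforce
  qed
  show thesis
  proof (rule that[OF C])
    fix i v s t assume i: "i \<in> {1..n-1}" and v: "v \<in> Hol"
    show "\<bar>l i (V v t)\<bar> \<le> C * H v"
      using le[OF i const_ext_in[OF v]] by (rule order_trans) (intro mult_left_mono const_ext_le v C)
    have "\<bar>l i (V v t - V v s)\<bar> \<le> C * N (V v t - V v s)"
      by (intro le i subspace_diff[OF subspace] const_ext_in v)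
    also have "\<dots> \<le> C * (H v * \<bar>t - s\<bar> powr \<alpha>)"
      by (intro mult_left_mono const_ext_holder v C)
    finally show "\<bar>l i (V v t) - l i (V v s)\<bar> \<le> C * (H v * \<bar>t - s\<bar> powr \<alpha>)"
      by (simp add: dual_diff[OF l[OF i]] const_ext_in[OF v])
  qed
qed

section \<open>The switching operator through antiderivatives\<close>

text \<open>The \<open>F i\<close> depend on \<open>v\<close> but not on \<open>\<tau>\<close>: the
  switching points occur only as arguments, which reduces differentiation in \<open>\<tau>\<close>
  to calculus in one variable.\<close>

lemma antiderivatives:
  assumes v: "v \<in> Hol"
  obtains F where "\<And>i x. i \<in> {1..n-1} \<Longrightarrow> (F i has_real_derivative l i (V v x)) (at x)"
    "\<And>\<tau>. B \<tau> v = (\<Sum>i=1..n-1. F i (\<tau> $ e (i+1)) - F i (\<tau> $ e i))"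
proof -
  have cont: "continuous_on UNIV (\<lambda>t. l i (V v t))" if "i \<in> {1..n-1}" for i
    by (rule continuous_dual_const_ext[OF l[OF that] v])
  have "\<forall>i. \<exists>F. i \<in> {1..n-1} \<longrightarrow> (\<forall>x. (F has_real_derivative l i (V v x)) (at x))"
    using antiderivative_UNIV[OF cont] by blast
  then obtain F where F: "\<And>i x. i \<in> {1..n-1} \<Longrightarrow> (F i has_real_derivative l i (V v x)) (at x)"
    by metis
  show thesis
  proof (rule that[of F, OF F])
    fix \<tau>
    have "B \<tau> v = (\<Sum>i=1..n-1. LINT t|lborel. chi_bar (\<tau> $ e i) (\<tau> $ e (i+1)) t * l i (V v t))"
      unfolding B_def if_P[OF v]
      by (rule Bochner_Integration.integral_sum) (rule chi_bar_integral(1)[OF cont F])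
    also have "\<dots> = (\<Sum>i=1..n-1. F i (\<tau> $ e (i+1)) - F i (\<tau> $ e i))"
      by (intro sum.cong refl) (rule chi_bar_integral(2)[OF cont F])
    finally show "B \<tau> v = (\<Sum>i=1..n-1. F i (\<tau> $ e (i+1)) - F i (\<tau> $ e i))" .
  qed
qed

lemma B_add:
  assumes u: "u \<in> Hol" and v: "v \<in> Hol"
  shows "B \<tau> (u + v) = B \<tau> u + B \<tau> v"
proof -
  \<comment> \<open>Additivity of the Bochner integral requires integrability of both
    integrands.\<close>
  have int: "integrable lborel (\<lambda>t. \<Sum>i=1..n-1. chi_bar (\<tau> $ e i) (\<tau> $ e (i+1)) t * l i (V w t))"
    if w: "w \<in> Hol" for w
  proof (rule Bochner_Integration.integrable_sum)
    fix i assume i: "i \<in> {1..n-1}"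
    have cont: "continuous_on UNIV (\<lambda>t. l i (V w t))"
      by (rule continuous_dual_const_ext[OF l[OF i] w])
    obtain F where F: "\<forall>x. (F has_real_derivative l i (V w x)) (at x)"
      using antiderivative_UNIV[OF cont] by blast
    from chi_bar_integral(1)[OF cont F[rule_format]]
    show "integrable lborel (\<lambda>t. chi_bar (\<tau> $ e i) (\<tau> $ e (i+1)) t * l i (V w t))" .
  qed
  have "(\<Sum>i=1..n-1. chi_bar (\<tau> $ e i) (\<tau> $ e (i+1)) t * l i (V (u + v) t))
    = (\<Sum>i=1..n-1. chi_bar (\<tau> $ e i) (\<tau> $ e (i+1)) t * l i (V u t))
      + (\<Sum>i=1..n-1. chi_bar (\<tau> $ e i) (\<tau> $ e (i+1)) t * l i (V v t))" for t
    unfolding sum.distrib[symmetric] const_ext_add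
    by (intro sum.cong refl) (simp add: l_add const_ext_in u v distrib_left)
  then show ?thesis
    using Bochner_Integration.integral_add[OF int[OF u] int[OF v]] u v holder_add[OF u v]
    unfolding B_def by simp
qed

lemma B_scaleR:
  assumes v: "v \<in> Hol"
  shows "B \<tau> (c *\<^sub>R v) = c * B \<tau> v"
proof -
  have "(\<Sum>i=1..n-1. chi_bar (\<tau> $ e i) (\<tau> $ e (i+1)) t * l i (V (c *\<^sub>R v) t))
    = c * (\<Sum>i=1..n-1. chi_bar (\<tau> $ e i) (\<tau> $ e (i+1)) t * l i (V v t))" for t
    unfolding sum_distrib_left
    by (intro sum.cong refl) (simp add: const_ext_scaleR l_scale const_ext_in[OF v])
  then show ?thesis
    using v holder_scaleR[OF v] unfolding B_def by simp
qed

lemma B_dual: "B \<tau> \<in> dual_space Hol H"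
proof -
  obtain C where C: "C \<ge> 0"
    "\<And>i v t. i \<in> {1..n-1} \<Longrightarrow> v \<in> Hol \<Longrightarrow> \<bar>l i (V v t)\<bar> \<le> C * H v"
    using bounds by metis
  have "\<bar>B \<tau> v\<bar> \<le> (\<Sum>i=1..n-1. \<bar>\<tau> $ e (i+1) - \<tau> $ e i\<bar> * C) * H v" if v: "v \<in> Hol" for v
  proof -
    obtain F where F: "\<And>i x. i \<in> {1..n-1} \<Longrightarrow> (F i has_real_derivative l i (V v x)) (at x)"
      and B: "\<And>\<tau>. B \<tau> v = (\<Sum>i=1..n-1. F i (\<tau> $ e (i+1)) - F i (\<tau> $ e i))"
      using antiderivatives[OF v] by blast
    have "\<bar>F i (\<tau> $ e (i+1)) - F i (\<tau> $ e i)\<bar> \<le> \<bar>\<tau> $ e (i+1) - \<tau> $ e i\<bar> * C * H v"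
      if i: "i \<in> {1..n-1}" for i
      using antiderivative_diff_le[OF F[OF i], of "\<tau> $ e i" "\<tau> $ e (i+1)" 0 "C * H v"] C(2)[OF i v]
      by (simp add: mult.assoc)
    then show ?thesis
      unfolding B sum_distrib_right by (intro order_trans[OF sum_abs sum_mono])
  qed
  then show ?thesis
    unfolding dual_space_def using B_add B_scaleR by (auto simp: B_def)
qed

lemma B'_dual: "B' \<tau> h \<in> dual_space Hol H"
proof -
  obtain C where C: "C \<ge> 0"
    "\<And>i v t. i \<in> {1..n-1} \<Longrightarrow> v \<in> Hol \<Longrightarrow> \<bar>l i (V v t)\<bar> \<le> C * H v"
    using bounds by metis
  have "\<bar>dB \<tau> h v\<bar> \<le> (\<Sum>i=1..n-1. (\<bar>h $ e (i+1)\<bar> + \<bar>h $ e i\<bar>) * C) * H v" if v: "v \<in> Hol" for v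
  proof -
    have "\<bar>h $ e (i+1) * l i (V v (\<tau> $ e (i+1))) - h $ e i * l i (V v (\<tau> $ e i))\<bar>
      \<le> (\<bar>h $ e (i+1)\<bar> + \<bar>h $ e i\<bar>) * C * H v" if i: "i \<in> {1..n-1}" for i
    proof -
      have "\<bar>h $ e (i+1) * l i (V v (\<tau> $ e (i+1))) - h $ e i * l i (V v (\<tau> $ e i))\<bar>
        \<le> \<bar>h $ e (i+1)\<bar> * \<bar>l i (V v (\<tau> $ e (i+1)))\<bar> + \<bar>h $ e i\<bar> * \<bar>l i (V v (\<tau> $ e i))\<bar>"
        unfolding abs_mult[symmetric] by (rule abs_triangle_ineq4)
      also have "\<dots> \<le> \<bar>h $ e (i+1)\<bar> * (C * H v) + \<bar>h $ e i\<bar> * (C * H v)"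
        by (intro add_mono mult_left_mono C i v) auto
      finally show ?thesis by (simp add: algebra_simps)
    qed
    then show ?thesis
      unfolding dB_eq[OF v] sum_distrib_right by (intro order_trans[OF sum_abs sum_mono])
  qed
  moreover have "dB \<tau> h (u + v) = dB \<tau> h u + dB \<tau> h v" if "u \<in> Hol" "v \<in> Hol" for u v
    unfolding dB_eq[OF that(1)] dB_eq[OF that(2)] dB_eq[OF holder_add[OF that]] sum.distrib[symmetric]
    using that by (intro sum.cong refl) (simp add: const_ext_add l_add const_ext_in algebra_simps)
  moreover have "dB \<tau> h (c *\<^sub>R v) = c * dB \<tau> h v" if "v \<in> Hol" for c v
    unfolding dB_eq[OF that] dB_eq[OF holder_scaleR[OF that]] sum_distrib_left
    using that by (intro sum.cong refl) (simp add: const_ext_scaleR l_scale const_ext_in algebra_simps)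
  ultimately show ?thesis
    unfolding dual_space_def B'_def using holder_add holder_scaleR by auto
qed

section \<open>Directional and Frechet derivatives\<close>

text \<open>For a fixed \<open>v\<close> this is the chain rule for the antiderivatives; no
  uniformity in \<open>v\<close> is involved, so it holds for \<open>\<alpha> = 0\<close> as
  well.\<close>

lemma B_directional_derivative:
  assumes v: "v \<in> Hol"
  shows "((\<lambda>s. B (\<tau> + s *\<^sub>R h) v) has_real_derivative dB \<tau> h v) (at 0)"
proof -
  obtain F where F: "\<And>i x. i \<in> {1..n-1} \<Longrightarrow> (F i has_real_derivative l i (V v x)) (at x)"
    and B: "\<And>\<tau>. B \<tau> v = (\<Sum>i=1..n-1. F i (\<tau> $ e (i+1)) - F i (\<tau> $ e i))"
    using antiderivatives[OF v] by blast
  have D: "((\<lambda>s. F i (\<tau> $ k + s * h $ k)) has_real_derivative l i (V v (\<tau> $ k)) * h $ k) (at 0)"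
    if i: "i \<in> {1..n-1}" for i k
    by (rule DERIV_chain2[where f = "F i"]) (auto intro!: derivative_eq_intros F i)
  show ?thesis
    unfolding B dB_eq[OF v] vector_add_component vector_scaleR_component
    by (intro DERIV_sum DERIV_diff) (use D in \<open>auto simp: mult.commute\<close>)
qed

lemma B'_linear: "linear (B' \<tau>)"
proof (rule linearI; rule ext)
  fix g h :: "real ^ 'n" and c v
  show "B' \<tau> (g + h) v = (B' \<tau> g + B' \<tau> h) v"
    by (simp add: B'_def dB_eq sum.distrib[symmetric] algebra_simps)
  show "B' \<tau> (c *\<^sub>R h) v = (c *\<^sub>R B' \<tau> h) v"
    by (simp add: B'_def dB_eq scaleR_fun_def sum_distrib_left algebra_simps)
qed

text \<open>The three estimates give boundedness of the derivative, the Frechet remainder and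
  continuity of the derivative. The constant \<open>R\<close> is independent of \<open>v\<close> in
  the unit ball, so each passes to the dual norm.\<close>

lemma remainder:
  obtains R where "R \<ge> 0"
    "\<And>\<tau> h v. v \<in> Hol \<Longrightarrow> H v \<le> 1 \<Longrightarrow> \<bar>B' \<tau> h v\<bar> \<le> R * norm h"
    "\<And>\<tau> h v. v \<in> Hol \<Longrightarrow> H v \<le> 1 \<Longrightarrow>
        \<bar>B (\<tau> + h) v - B \<tau> v - B' \<tau> h v\<bar> \<le> R * (norm h * norm h powr \<alpha>)"
    "\<And>\<sigma> \<tau> h v. v \<in> Hol \<Longrightarrow> H v \<le> 1 \<Longrightarrow>
        \<bar>B' \<sigma> h v - B' \<tau> h v\<bar> \<le> R * (norm h * norm (\<sigma> - \<tau>) powr \<alpha>)"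
proof -
  obtain C where C: "C \<ge> 0"
    and le: "\<And>i v t. i \<in> {1..n-1} \<Longrightarrow> v \<in> Hol \<Longrightarrow> \<bar>l i (V v t)\<bar> \<le> C * H v"
    and holder: "\<And>i v s t. i \<in> {1..n-1} \<Longrightarrow> v \<in> Hol \<Longrightarrow>
        \<bar>l i (V v t) - l i (V v s)\<bar> \<le> C * (H v * \<bar>t - s\<bar> powr \<alpha>)"
    using bounds by metis
  define R where "R = real (n - 1) * (2 * C)"
  \<comment> \<open>All three quantities are sums of differences between the coordinates
    \<open>e (i+1)\<close> and \<open>e i\<close>, so a bound \<open>C * m\<close> on each term
    gives \<open>R = 2 * C * (n - 1)\<close>.\<close>
  have sum_le: "\<bar>\<Sum>i=1..n-1. a i (e (i+1)) - a i (e i)\<bar> \<le> R * m"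
    if "\<And>i k. i \<in> {1..n-1} \<Longrightarrow> \<bar>a i k\<bar> \<le> C * m" for a :: "nat \<Rightarrow> 'n \<Rightarrow> real" and m
  proof -
    have "\<bar>\<Sum>i=1..n-1. a i (e (i+1)) - a i (e i)\<bar> \<le> (\<Sum>i=1..n-1. 2 * C * m)"
    proof (intro order_trans[OF sum_abs sum_mono])
      fix i assume "i \<in> {1..n-1}"
      from that[OF this, of "e (i+1)"] that[OF this, of "e i"]
      show "\<bar>a i (e (i+1)) - a i (e i)\<bar> \<le> 2 * C * m" by linarith
    qed
    then show ?thesis unfolding R_def by simp
  qed
  have unit: "C * (H v * x powr \<alpha>) \<le> C * y powr \<alpha>" if "H v \<le> 1" "0 \<le> x" "x \<le> y" for v x y
  proof (rule mult_left_mono[OF _ C])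
    have "H v * x powr \<alpha> \<le> 1 * y powr \<alpha>"
      using that \<alpha> by (intro mult_mono powr_mono2) auto
    then show "H v * x powr \<alpha> \<le> y powr \<alpha>" by simp
  qed
  show thesis
  proof (rule that[of R])
    show "R \<ge> 0" unfolding R_def using C by simp
    fix \<sigma> \<tau> h :: "real ^ 'n" and v assume v: "v \<in> Hol" "H v \<le> 1"
    have "\<bar>h $ k * l i (V v (\<tau> $ k))\<bar> \<le> C * norm h" if i: "i \<in> {1..n-1}" for i k
    proof -
      have "\<bar>l i (V v (\<tau> $ k))\<bar> \<le> C"
        using le[OF i v(1), of "\<tau> $ k"] mult_left_mono[OF v(2) C] by simp
      then have "\<bar>h $ k\<bar> * \<bar>l i (V v (\<tau> $ k))\<bar> \<le> norm h * C"
        by (intro mult_mono component_le_norm_cart) auto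
      then show ?thesis by (simp add: abs_mult mult.commute)
    qed
    then show "\<bar>B' \<tau> h v\<bar> \<le> R * norm h"
      using v sum_le[of "\<lambda>i k. h $ k * l i (V v (\<tau> $ k))"] by (simp add: B'_def dB_eq)
    obtain F where F: "\<And>i x. i \<in> {1..n-1} \<Longrightarrow> (F i has_real_derivative l i (V v x)) (at x)"
      and B: "\<And>\<tau>. B \<tau> v = (\<Sum>i=1..n-1. F i (\<tau> $ e (i+1)) - F i (\<tau> $ e i))"
      using antiderivatives[OF v(1)] by blast
    \<comment> \<open>The integrand differs from its value at \<open>\<tau> $ k\<close> by at most
      \<open>C * norm h powr \<alpha>\<close> on the interval between the old and the new switching
      point, whose length is at most \<open>norm h\<close>.\<close>
    have "\<bar>F i (\<tau> $ k + h $ k) - F i (\<tau> $ k) - h $ k * l i (V v (\<tau> $ k))\<bar>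
        \<le> C * (norm h * norm h powr \<alpha>)" if i: "i \<in> {1..n-1}" for i k
    proof -
      have hk: "\<bar>h $ k\<bar> \<le> norm h" by (rule component_le_norm_cart)
      have "\<bar>l i (V v t) - l i (V v (\<tau> $ k))\<bar> \<le> C * norm h powr \<alpha>" if "\<bar>t - \<tau> $ k\<bar> \<le> \<bar>h $ k\<bar>" for t
        using that hk by (intro order_trans[OF holder[OF i v(1)] unit] v) auto
      then have "\<bar>F i (\<tau> $ k + h $ k) - F i (\<tau> $ k) - h $ k * l i (V v (\<tau> $ k))\<bar>
          \<le> \<bar>h $ k\<bar> * (C * norm h powr \<alpha>)"
        using antiderivative_diff_le[OF F[OF i], of "\<tau> $ k" "\<tau> $ k + h $ k" "l i (V v (\<tau> $ k))"] by simp
      also have "\<dots> \<le> norm h * (C * norm h powr \<alpha>)"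
        using hk C by (intro mult_right_mono) auto
      finally show ?thesis by (simp add: mult.left_commute)
    qed
    from sum_le[of "\<lambda>i k. F i (\<tau> $ k + h $ k) - F i (\<tau> $ k) - h $ k * l i (V v (\<tau> $ k))", OF this]
    show "\<bar>B (\<tau> + h) v - B \<tau> v - B' \<tau> h v\<bar> \<le> R * (norm h * norm h powr \<alpha>)"
      using v(1) by (simp add: B B'_def dB_eq sum_subtractf[symmetric] algebra_simps)
    have "\<bar>h $ k * (l i (V v (\<sigma> $ k)) - l i (V v (\<tau> $ k)))\<bar>
        \<le> C * (norm h * norm (\<sigma> - \<tau>) powr \<alpha>)" if i: "i \<in> {1..n-1}" for i k
    proof -
      have "\<bar>l i (V v (\<sigma> $ k)) - l i (V v (\<tau> $ k))\<bar> \<le> C * norm (\<sigma> - \<tau>) powr \<alpha>"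
        using component_le_norm_cart[of "\<sigma> - \<tau>" k]
        by (intro order_trans[OF holder[OF i v(1)] unit] v) auto
      then have "\<bar>h $ k\<bar> * \<bar>l i (V v (\<sigma> $ k)) - l i (V v (\<tau> $ k))\<bar>
          \<le> norm h * (C * norm (\<sigma> - \<tau>) powr \<alpha>)"
        by (intro mult_mono component_le_norm_cart) auto
      then show ?thesis by (simp add: abs_mult mult.left_commute)
    qed
    from sum_le[of "\<lambda>i k. h $ k * (l i (V v (\<sigma> $ k)) - l i (V v (\<tau> $ k)))", OF this]
    show "\<bar>B' \<sigma> h v - B' \<tau> h v\<bar> \<le> R * (norm h * norm (\<sigma> - \<tau>) powr \<alpha>)"
      using v(1) by (simp add: B'_def dB_eq sum_subtractf[symmetric] algebra_simps)
  qed
qed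

text \<open>Division of the remainder by \<open>norm h\<close> leaves
  \<open>R * norm h powr \<alpha>\<close>, which tends to 0 exactly because
  \<open>\<alpha> > 0\<close>; the operator norm of the difference of two derivatives is handled by
  the same power.\<close>

lemma B_frechet:
  assumes \<alpha>_pos: "\<alpha> > 0"
  shows "cont_frechet_diff_into (dual_space Hol H) (dual_norm Hol H) B B'"
proof -
  have "H 0 \<le> 1" by (simp add: holder_zero)
  note holder_dual_normI = dual_normI[where E = Hol and N = H, OF holder_zero(1) this]
  obtain R where R: "R \<ge> 0"
    and b1: "\<And>\<tau> h v. v \<in> Hol \<Longrightarrow> H v \<le> 1 \<Longrightarrow> \<bar>B' \<tau> h v\<bar> \<le> R * norm h"
    and b2: "\<And>\<tau> h v. v \<in> Hol \<Longrightarrow> H v \<le> 1 \<Longrightarrow>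
        \<bar>B (\<tau> + h) v - B \<tau> v - B' \<tau> h v\<bar> \<le> R * (norm h * norm h powr \<alpha>)"
    and b3: "\<And>\<sigma> \<tau> h v. v \<in> Hol \<Longrightarrow> H v \<le> 1 \<Longrightarrow>
        \<bar>B' \<sigma> h v - B' \<tau> h v\<bar> \<le> R * (norm h * norm (\<sigma> - \<tau>) powr \<alpha>)"
    using remainder by metis
  have "bounded_linear_into (dual_space Hol H) (dual_norm Hol H) (B' \<tau>)" for \<tau>
  proof -
    have "dual_norm Hol H (B' \<tau> h) \<le> R * norm h" for h
      by (rule holder_dual_normI(2)[OF b1])
    then show ?thesis
      unfolding bounded_linear_into_def using B'_linear B'_dual by blast
  qed
  moreover have "((\<lambda>h. dual_norm Hol H (B (\<tau> + h) - B \<tau> - B' \<tau> h) / norm h) \<longlongrightarrow> 0) (at 0)" for \<tau>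
  proof (rule tendsto_sandwich[OF _ _ tendsto_const])
    have n: "0 \<le> dual_norm Hol H (B (\<tau> + h) - B \<tau> - B' \<tau> h)"
      "dual_norm Hol H (B (\<tau> + h) - B \<tau> - B' \<tau> h) \<le> R * (norm h * norm h powr \<alpha>)" for h
    proof -
      have le: "\<bar>(B (\<tau> + h) - B \<tau> - B' \<tau> h) v\<bar> \<le> R * (norm h * norm h powr \<alpha>)"
        if "v \<in> Hol" "H v \<le> 1" for v
        using b2[OF that] by simp
      from le show "0 \<le> dual_norm Hol H (B (\<tau> + h) - B \<tau> - B' \<tau> h)"
        by (rule holder_dual_normI(1))
      from le show "dual_norm Hol H (B (\<tau> + h) - B \<tau> - B' \<tau> h) \<le> R * (norm h * norm h powr \<alpha>)"
        by (rule holder_dual_normI(2))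
    qed
    then show "\<forall>\<^sub>F h in at 0. 0 \<le> dual_norm Hol H (B (\<tau> + h) - B \<tau> - B' \<tau> h) / norm h"
      by simp
    have "dual_norm Hol H (B (\<tau> + h) - B \<tau> - B' \<tau> h) / norm h \<le> R * norm h powr \<alpha>" if "h \<noteq> 0" for h
      using n(2)[of h] that by (simp add: divide_le_eq mult_ac)
    then show "\<forall>\<^sub>F h in at 0. dual_norm Hol H (B (\<tau> + h) - B \<tau> - B' \<tau> h) / norm h \<le> R * norm h powr \<alpha>"
      by (auto simp: eventually_at intro!: exI[of _ 1])
    show "((\<lambda>h :: real ^ 'n. R * norm h powr \<alpha>) \<longlongrightarrow> 0) (at 0)"
      using \<alpha>_pos by (intro tendsto_mult_right_zero tendsto_zero_powrI tendsto_norm_zero tendsto_ident_at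
          tendsto_const) auto
  qed
  moreover have "((\<lambda>\<sigma>. SUP h\<in>cball 0 1. dual_norm Hol H (B' \<sigma> h - B' \<tau> h)) \<longlongrightarrow> 0) (at \<tau>)" for \<tau>
  proof (rule tendsto_sandwich[OF _ _ tendsto_const])
    have n: "0 \<le> dual_norm Hol H (B' \<sigma> h - B' \<tau> h)"
      "dual_norm Hol H (B' \<sigma> h - B' \<tau> h) \<le> R * norm (\<sigma> - \<tau>) powr \<alpha>" if "h \<in> cball 0 1" for \<sigma> h
    proof -
      have "R * (norm h * norm (\<sigma> - \<tau>) powr \<alpha>) \<le> R * norm (\<sigma> - \<tau>) powr \<alpha>"
        using that R by (intro mult_left_mono mult_left_le_one_le) auto
      then have le: "\<bar>(B' \<sigma> h - B' \<tau> h) v\<bar> \<le> R * norm (\<sigma> - \<tau>) powr \<alpha>" if "v \<in> Hol" "H v \<le> 1" for v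
        using b3[OF that, of \<sigma> h \<tau>] by simp
      from le show "0 \<le> dual_norm Hol H (B' \<sigma> h - B' \<tau> h)"
        by (rule holder_dual_normI(1))
      from le show "dual_norm Hol H (B' \<sigma> h - B' \<tau> h) \<le> R * norm (\<sigma> - \<tau>) powr \<alpha>"
        by (rule holder_dual_normI(2))
    qed
    \<comment> \<open>The supremum dominates its value at \<open>h = 0\<close>; the uniform bound
      over the ball makes it a genuine real supremum.\<close>
    have "0 \<le> (SUP h\<in>cball 0 1. dual_norm Hol H (B' \<sigma> h - B' \<tau> h))" for \<sigma>
      using n by (intro cSUP_upper2[where x = 0]) (auto intro!: bdd_aboveI2[of _ _ "R * norm (\<sigma> - \<tau>) powr \<alpha>"])
    then show "\<forall>\<^sub>F \<sigma> in at \<tau>. 0 \<le> (SUP h\<in>cball 0 1. dual_norm Hol H (B' \<sigma> h - B' \<tau> h))" by simp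
    have "(SUP h\<in>cball 0 1. dual_norm Hol H (B' \<sigma> h - B' \<tau> h)) \<le> R * norm (\<sigma> - \<tau>) powr \<alpha>" for \<sigma>
      using n by (intro cSUP_least) auto
    then show "\<forall>\<^sub>F \<sigma> in at \<tau>. (SUP h\<in>cball 0 1. dual_norm Hol H (B' \<sigma> h - B' \<tau> h))
        \<le> R * norm (\<sigma> - \<tau>) powr \<alpha>" by simp
    have "((\<lambda>\<sigma>. norm (\<sigma> - \<tau>)) \<longlongrightarrow> 0) (at \<tau>)"
      by (intro tendsto_norm_zero LIM_zero tendsto_ident_at)
    then show "((\<lambda>\<sigma>. R * norm (\<sigma> - \<tau>) powr \<alpha>) \<longlongrightarrow> 0) (at \<tau>)"
      using \<alpha>_pos by (intro tendsto_mult_right_zero tendsto_zero_powrI tendsto_const) auto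
  qed
  ultimately show ?thesis
    unfolding cont_frechet_diff_into_def frechet_deriv_into_def using B_dual by blast
qed

end

text \<open>For \<open>\<alpha> = 0\<close> the remainder bound is only of order
  \<open>norm h\<close>, as the unit ball of continuous functions has in general no common modulus
  of continuity. The Frechet statement is therefore made for \<open>\<alpha> > 0\<close>, while the
  derivative formula at each fixed \<open>v\<close> includes \<open>\<alpha> = 0\<close>.\<close>

theorem theorem3p3:
  fixes T q q' \<theta> \<alpha> :: real
    and n :: nat
    and e :: "nat \<Rightarrow> 'n::finite"
    and \<iota> :: "'d::banach \<Rightarrow>\<^sub>L 'x::banach"
    and \<psi> :: "nat \<Rightarrow> 'x"
  defines "Hol \<equiv> holder_space T \<alpha> (Z_space \<iota> \<theta>) (Z_norm \<iota> \<theta>)"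
    and "Hnorm \<equiv> holder_norm T \<alpha> (Z_norm \<iota> \<theta>)"
    and "B \<equiv> switching_op \<iota> \<theta> T \<alpha> n e \<psi>"
    and "dB \<equiv> (\<lambda>(\<tau> :: real ^ 'n) (h :: real ^ 'n) v.
           \<Sum>i=1..n-1. Z_pairing \<iota> \<theta> (\<psi> i)
             (h $ e (i+1) *\<^sub>R const_ext T v (\<tau> $ e (i+1)) - h $ e i *\<^sub>R const_ext T v (\<tau> $ e i)))"
  assumes "T > 0"
    and "1 < q" and "1 / q + 1 / q' = 1"
    and "n \<ge> 2" and "bij_betw e {1..n} UNIV"
    and "reflexive TYPE('x)" and "reflexive TYPE('d)"
    and "inj (blinfun_apply \<iota>)" and "closure (range (blinfun_apply \<iota>)) = UNIV"
    and "1 / q' < \<theta>" and "\<theta> < 1"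
    and "\<forall>i\<in>{1..n-1}. \<psi> i \<in> interp_space (\<lambda>x. x) (blinfun_apply \<iota>) \<theta> \<infinity>"
    and "0 \<le> \<alpha>" and "\<alpha> < \<theta> - 1 / q'"
  shows "(\<forall>\<tau>. B \<tau> \<in> dual_space Hol Hnorm) \<and>
    (\<forall>\<tau> h. \<forall>v\<in>Hol. ((\<lambda>s. B (\<tau> + s *\<^sub>R h) v) has_real_derivative dB \<tau> h v) (at 0)) \<and>
    (\<alpha> > 0 \<longrightarrow>
      (\<exists>B'. cont_frechet_diff_into (dual_space Hol Hnorm) (dual_norm Hol Hnorm) B B' \<and>
            (\<forall>\<tau> h. \<forall>v\<in>Hol. B' \<tau> h v = dB \<tau> h v)))"
proof -
  \<comment> \<open>Since \<open>1 / q' = 1 - 1 / q\<close> is positive, so is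
    \<open>\<theta>\<close>, as the locale \<open>dual_couple\<close> demands.\<close>
  have "1 / q < 1" using \<open>1 < q\<close> by simp
  then have "0 < \<theta>" using \<open>1 / q + 1 / q' = 1\<close> \<open>1 / q' < \<theta>\<close> by linarith
  then interpret dual_couple \<iota> \<theta>
    using \<open>\<theta> < 1\<close> by unfold_locales
  interpret S: switching "Z_space \<iota> \<theta>" "Z_norm \<iota> \<theta>" T \<alpha> n e "\<lambda>i. Z_pairing \<iota> \<theta> (\<psi> i)"
    using assms Z_pairing_dual by unfold_locales auto
  have "B = S.B" "dB = S.dB"
    unfolding B_def dB_def S.B_def S.dB_def switching_op_def by (auto simp: fun_eq_iff)
  moreover have "\<forall>\<tau> h. \<forall>v\<in>Hol. S.B' \<tau> h v = S.dB \<tau> h v"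
    unfolding Hol_def by (simp add: S.B'_def)
  ultimately show ?thesis
    using S.B_dual S.B_directional_derivative S.B_frechet unfolding Hol_def Hnorm_def by blast
qed

end
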